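(* Fix positive integers $m,k$, confidence levels $\eta_1,\dots,\eta_m\in(1/2,1)$, constants $0<\underline d\le\bar d<\infty$, and a probability distribution $\mathcal P$ with bounded support on tuples $(\bm c,\bar{\bm a}_1,\dots,\bar{\bm a}_m,\bm K_1,\dots,\bm K_m)$, where $\bm c,\bar{\bm a}_j\in\mathbb R^k$ and each $\bm K_j\in\mathbb R^{k\times k}$ is a covariance (symmetric positive semidefinite) matrix. For each $n\ge 1$ let $\bm b\in\mathbb R^m$ (possibly depending on $n$) satisfy $\underline d\le b_j/n\le\bar d$ for all $j=1,\dots,m$, and let the coefficient tuples $(\bm c_t,\bar{\bm a}_{t1},\dots,\bar{\bm a}_{tm},\bm K_{t1},\dots,\bm K_{tm})$, $t=1,\dots,n$, be sampled i.i.d. from $\mathcal P$ (which is unknown to the algorithm). Let $\hat R_n^{ISOCP}$ be the optimal value of the integer second-order cone program and $\bm x=(\bm x_1,\dots,\bm x_n)$ the output of the online primal-dual (OPD) algorithm, both described in the context. Then the expected regret and the expected constraint violation are of order $\sqrt n$: there is a constant $C$ not depending on $n$ or on $\bm b$ such that for all $n\ge 1$ $$\mathbb E\Big[\hat R_n^{ISOCP}-\sum_{t=1}^n\bm c_t^\top\bm x_t\Big]\le C\sqrt n ,\qquad \mathbb E\Big[\big\|(\bm g(\bm x)-\bm b)^+\big\|_2\Big]\le C\sqrt n ,$$ where $\bm g(\bm x)=(g_1(\bm x),\dots,g_m(\bm x))^\top$ is the left-hand side of the second-order cone constraints, $(\cdot)^+$ is the componentwise positive part, and the expectation is over the random coefficients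 (and the random tie-breaking of the algorithm).
   Context: $\Phi$ is the cumulative distribution function of the standard Gaussian distribution, $\bm e_l\in\mathbb R^k$ is the $l$-th standard unit vector, and $\bm 1$ is the all-ones vector. Integer second-order cone program (ISOCP). Given coefficients $\bm c_t,\bar{\bm a}_{tj}\in\mathbb R^k$, covariance matrices $\bm K_{tj}\in\mathbb R^{k\times k}$ ($t=1,\dots,n$, $j=1,\dots,m$), levels $\eta_j$, and capacities $\bm b=(b_1,\dots,b_m)^\top$, set, for $\bm x=(\bm x_1,\dots,\bm x_n)$, $$g_j(\bm x)=\sum_{t=1}^n\bar{\bm a}_{tj}^\top\bm x_t+\Phi^{-1}(\eta_j)\sqrt{\sum_{t=1}^n\bm x_t^\top\bm K_{tj}\bm x_t},\quad j=1,\dots,m.$$ The program is: maximize $\sum_{t=1}^n\bm c_t^\top\bm x_t$ subject to $g_j(\bm x)\le b_j$ for all $j=1,\dots,m$, and $\bm x_t\in\{0,1\}^k$, $\bm 1^\top\bm x_t\le 1$ for all $t=1,\dots,n$. Its optimal value is $\hat R_n^{ISOCP}$. OPD algorithm. Let $\bm\gamma_{tj}\in\mathbb R^k$ be the vector of square roots of the diagonal entries of $\bm K_{tj}$, let $\tilde{\bm a}_{tj}=\bar{\bm a}_{tj}+\Phi^{-1}(\eta_j)\bm\gamma_{tj}/\sqrt n$, let $\tilde{\bm A}_t\in\mathbb R^{m\times k}$ be the matrix whose $j$-th row is $\tilde{\bm a}_{tj}^\top$, and let $\bm d=\bm b/n$. Start with $\bm p_1=\bm 0\in\mathbb R^m$.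 For $t=1,\dots,n$: (i) compute $v_t=\max_{l=1,\dots,k}(\bm c_t^\top-\bm p_t^\top\tilde{\bm A}_t)\bm e_l$; (ii) if $v_t>0$, pick an index $l_t$ at random from $\{l: v_t=(\bm c_t^\top-\bm p_t^\top\tilde{\bm A}_t)\bm e_l\}$ and set $\bm x_t=\bm e_{l_t}$; otherwise set $\bm x_t=\bm 0$; (iii) update $\bm p_{t+1}=\max\{\bm p_t+\tfrac{1}{\sqrt n}(\tilde{\bm A}_t\bm x_t-\bm d),\bm 0\}$, with the maximum taken componentwise. The output is $\bm x=(\bm x_1,\dots,\bm x_n)$. *)

theory Defs
  imports "HOL-Probability.Probability"
begin


text \<open>
  A coefficient tuple is \<open>(c, A, K)\<close>: the \<open>j\<close>-th row \<open>A $ j\<close> is the mean vector of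
  constraint \<open>j\<close>, and \<open>K $ j\<close> is its covariance matrix. The cardinalities of the index
  types \<open>'k\<close> and \<open>'m\<close> are the positive integers \<open>k\<close> and \<open>m\<close>.
  A sample is a sequence of such tuples, of which the program of size \<open>n\<close> uses the
  entries with index in \<open>{1..n}\<close>.
\<close>

type_synonym ('k, 'm) coeffs = "(real ^ 'k) \<times> (real ^ 'k ^ 'm) \<times> (real ^ 'k ^ 'k ^ 'm)"

definition obj_coeff :: "('k::finite, 'm::finite) coeffs \<Rightarrow> real ^ 'k" where
  "obj_coeff \<xi> = fst \<xi>"

definition mean_coeff :: "('k::finite, 'm::finite) coeffs \<Rightarrow> 'm \<Rightarrow> real ^ 'k" where
  "mean_coeff \<xi> j = fst (snd \<xi>) $ j"

definition cov_coeff :: "('k::finite, 'm::finite) coeffs \<Rightarrow> 'm \<Rightarrow> real ^ 'k ^ 'k" where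
  "cov_coeff \<xi> j = snd (snd \<xi>) $ j"

definition covariance_matrix :: "real ^ 'k ^ 'k \<Rightarrow> bool" where
  "covariance_matrix K \<longleftrightarrow> transpose K = K \<and> (\<forall>x. 0 \<le> x \<bullet> (K *v x))"

definition topological_support :: "'a::topological_space measure \<Rightarrow> 'a set" where
  "topological_support P = {x. \<forall>U. open U \<longrightarrow> x \<in> U \<longrightarrow> 0 < emeasure P U}"

text \<open>
  The standard Gaussian cdf is a strictly increasing bijection onto the open unit interval,
  so \<open>inv\<close> is its genuine inverse at every level strictly between 0 and 1.
\<close>

definition std_normal_quantile :: "real \<Rightarrow> real" where
  "std_normal_quantile = inv (cdf std_normal_distribution)"


subsection \<open>The integer second-order cone program\<close>

definition socp_lhs ::
  "real ^ 'm \<Rightarrow> nat \<Rightarrow> (nat \<Rightarrow> ('k::finite, 'm::finite) coeffs) \<Rightarrow> (nat \<Rightarrow> real ^ 'k) \<Rightarrow> real ^ 'm"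
where
  "socp_lhs \<eta> n \<omega> x =
     (\<chi> j. (\<Sum>t=1..n. mean_coeff (\<omega> t) j \<bullet> x t)
        + std_normal_quantile (\<eta> $ j) * sqrt (\<Sum>t=1..n. x t \<bullet> (cov_coeff (\<omega> t) j *v x t)))"

definition objective ::
  "nat \<Rightarrow> (nat \<Rightarrow> ('k::finite, 'm::finite) coeffs) \<Rightarrow> (nat \<Rightarrow> real ^ 'k) \<Rightarrow> real"
where
  "objective n \<omega> x = (\<Sum>t=1..n. obj_coeff (\<omega> t) \<bullet> x t)"

text \<open>In \<open>1 \<bullet> x t\<close> the \<open>1\<close> is the all-ones vector.\<close>

definition isocp_feasible ::
  "real ^ 'm \<Rightarrow> nat \<Rightarrow> real ^ 'm \<Rightarrow> (nat \<Rightarrow> ('k::finite, 'm::finite) coeffs) \<Rightarrow> (nat \<Rightarrow> real ^ 'k) set"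
where
  "isocp_feasible \<eta> n b \<omega> =
     {x. (\<forall>j. socp_lhs \<eta> n \<omega> x $ j \<le> b $ j) \<and>
         (\<forall>t\<in>{1..n}. (\<forall>l. x t $ l \<in> {0, 1}) \<and> 1 \<bullet> x t \<le> 1)}"

text \<open>
  The objective takes finitely many values on the feasible set, which contains the zero
  solution when \<open>b\<close> is nonnegative; in that case the supremum is an attained maximum.
\<close>

definition isocp_value ::
  "real ^ 'm \<Rightarrow> nat \<Rightarrow> real ^ 'm \<Rightarrow> (nat \<Rightarrow> ('k::finite, 'm::finite) coeffs) \<Rightarrow> real"
where
  "isocp_value \<eta> n b \<omega> = (SUP x \<in> isocp_feasible \<eta> n b \<omega>. objective n \<omega> x)"


subsection \<open>The online primal-dual algorithm\<close>

definition diag_sqrt :: "real ^ 'k ^ 'k \<Rightarrow> real ^ 'k" where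
  "diag_sqrt K = (\<chi> l. sqrt (K $ l $ l))"

definition adj_matrix ::
  "real ^ 'm \<Rightarrow> nat \<Rightarrow> ('k::finite, 'm::finite) coeffs \<Rightarrow> real ^ 'k ^ 'm"
where
  "adj_matrix \<eta> n \<xi> =
     (\<chi> j. mean_coeff \<xi> j
        + (std_normal_quantile (\<eta> $ j) / sqrt (real n)) *\<^sub>R diag_sqrt (cov_coeff \<xi> j))"

definition score ::
  "real ^ 'm \<Rightarrow> nat \<Rightarrow> real ^ 'm \<Rightarrow> ('k::finite, 'm::finite) coeffs \<Rightarrow> 'k \<Rightarrow> real"
where
  "score \<eta> n p \<xi> l = (obj_coeff \<xi> - p v* adj_matrix \<eta> n \<xi>) \<bullet> axis l 1"

text \<open>Ties are broken uniformly at random, independently of everything else.\<close>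

definition opd_decision ::
  "real ^ 'm \<Rightarrow> nat \<Rightarrow> real ^ 'm \<Rightarrow> ('k::finite, 'm::finite) coeffs \<Rightarrow> (real ^ 'k) pmf"
where
  "opd_decision \<eta> n p \<xi> =
     (let v = Max (range (score \<eta> n p \<xi>)) in
      if v > 0 then map_pmf (\<lambda>l. axis l 1) (pmf_of_set {l. v = score \<eta> n p \<xi> l})
      else return_pmf 0)"

definition dual_update ::
  "real ^ 'm \<Rightarrow> nat \<Rightarrow> real ^ 'm \<Rightarrow> real ^ 'm \<Rightarrow> ('k::finite, 'm::finite) coeffs \<Rightarrow> real ^ 'k
     \<Rightarrow> real ^ 'm"
where
  "dual_update \<eta> n b p \<xi> z =
     (\<chi> j. max ((p + (1 / sqrt (real n)) *\<^sub>R (adj_matrix \<eta> n \<xi> *v z - b /\<^sub>R real n)) $ j) 0)"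

text \<open>
  The state after round \<open>t\<close> is \<open>(x, p)\<close>, where \<open>x\<close> holds the decisions of rounds
  \<open>1, \<dots>, t\<close> (and is zero elsewhere) and \<open>p\<close> is the dual price of round \<open>t + 1\<close>. The
  result is the law of this state over the tie-breaking, for a given sample \<open>\<omega>\<close>.
\<close>

primrec opd_state ::
  "real ^ 'm \<Rightarrow> nat \<Rightarrow> real ^ 'm \<Rightarrow> (nat \<Rightarrow> ('k::finite, 'm::finite) coeffs) \<Rightarrow> nat
     \<Rightarrow> ((nat \<Rightarrow> real ^ 'k) \<times> (real ^ 'm)) pmf"
where
  "opd_state \<eta> n b \<omega> 0 = return_pmf (\<lambda>_. 0, 0)"
| "opd_state \<eta> n b \<omega> (Suc t) =
     bind_pmf (opd_state \<eta> n b \<omega> t) (\<lambda>(x, p).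
       map_pmf (\<lambda>z. (x(Suc t := z), dual_update \<eta> n b p (\<omega> (Suc t)) z))
         (opd_decision \<eta> n p (\<omega> (Suc t))))"

definition opd_output ::
  "real ^ 'm \<Rightarrow> nat \<Rightarrow> real ^ 'm \<Rightarrow> (nat \<Rightarrow> ('k::finite, 'm::finite) coeffs)
     \<Rightarrow> (nat \<Rightarrow> real ^ 'k) pmf"
where
  "opd_output \<eta> n b \<omega> = map_pmf fst (opd_state \<eta> n b \<omega> n)"


subsection \<open>Regret, constraint violation and their expectations\<close>

definition regret ::
  "real ^ 'm \<Rightarrow> nat \<Rightarrow> real ^ 'm \<Rightarrow> (nat \<Rightarrow> ('k::finite, 'm::finite) coeffs) \<Rightarrow> (nat \<Rightarrow> real ^ 'k)
     \<Rightarrow> real"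
where
  "regret \<eta> n b \<omega> x = isocp_value \<eta> n b \<omega> - objective n \<omega> x"

definition violation ::
  "real ^ 'm \<Rightarrow> nat \<Rightarrow> real ^ 'm \<Rightarrow> (nat \<Rightarrow> ('k::finite, 'm::finite) coeffs) \<Rightarrow> (nat \<Rightarrow> real ^ 'k)
     \<Rightarrow> real"
where
  "violation \<eta> n b \<omega> x = norm (\<chi> j. max ((socp_lhs \<eta> n \<omega> x - b) $ j) 0)"

definition sample_measure ::
  "('k::finite, 'm::finite) coeffs measure \<Rightarrow> nat \<Rightarrow> (nat \<Rightarrow> ('k, 'm) coeffs) measure"
where
  "sample_measure P n = Pi\<^sub>M {1..n} (\<lambda>_. P)"

text \<open>Expectation over the tie-breaking only; the law of the output has finite support.\<close>

definition tie_expectation ::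
  "real ^ 'm \<Rightarrow> nat \<Rightarrow> real ^ 'm
     \<Rightarrow> ((nat \<Rightarrow> ('k::finite, 'm::finite) coeffs) \<Rightarrow> (nat \<Rightarrow> real ^ 'k) \<Rightarrow> real)
     \<Rightarrow> (nat \<Rightarrow> ('k, 'm) coeffs) \<Rightarrow> real"
where
  "tie_expectation \<eta> n b f \<omega> = measure_pmf.expectation (opd_output \<eta> n b \<omega>) (f \<omega>)"

end

theory Submission
  imports Defs
begin

text \<open>
  On binary decisions \<open>x\<^sub>t \<bullet> K\<^sub>t x\<^sub>t\<close> equals \<open>(\<gamma>\<^sub>t \<bullet> x\<^sub>t)\<^sup>2\<close>, so by Cauchy--Schwarz the linear
  constraints with the adjusted matrices relax the conic ones. By weak duality the optimal
  value is then at most \<open>\<Sum>t. h(p, \<xi>\<^sub>t)\<close> for every price \<open>p \<ge> 0\<close>, where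
  \<open>h(p, \<xi>) = d \<bullet> p + max 0 (max\<^sub>l score)\<close>; hence its expectation is at most \<open>n E h(p, \<xi>)\<close>.
  The price \<open>p\<^sub>t\<close> is independent of \<open>\<xi>\<^sub>t\<close>, so it may be inserted for \<open>p\<close> in round \<open>t\<close>. The
  reward of round \<open>t\<close> falls short of \<open>h(p\<^sub>t, \<xi>\<^sub>t)\<close> by \<open>p\<^sub>t \<bullet> (d - A\<^sub>t x\<^sub>t)\<close>, and expanding
  \<open>\<parallel>p\<^sub>t\<^sub>+\<^sub>1\<parallel>\<^sup>2\<close> shows that these terms telescope to \<open>O(sqrt n)\<close>. The same expansion has negative
  drift for large prices because \<open>d \<bullet> p \<ge> d_lo \<parallel>p\<parallel>\<close>, so the prices stay bounded; since
  \<open>\<Sum>t. A\<^sub>t x\<^sub>t - d \<le> sqrt n p\<^sub>n\<^sub>+\<^sub>1\<close>, this bounds the violation.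
\<close>

subsection \<open>The Gaussian quantile and the support of a measure\<close>

lemma measure_null_singleton_std_normal: "measure std_normal_distribution {x} = 0"
proof -
  have "AE y in lborel. y \<noteq> x" by (rule AE_lborel_singleton)
  hence "emeasure std_normal_distribution {x} = 0"
    by (subst emeasure_density) (auto simp: nn_integral_0_iff_AE indicator_def elim!: eventually_mono)
  thus ?thesis by (simp add: measure_def)
qed

text \<open>The substitution \<open>x\<close> to \<open>- x\<close> preserves the density, so both
  half-lines have equal mass, and their common point 0 is null.\<close>

lemma cdf_std_normal_0: "cdf std_normal_distribution 0 = 1/2"
proof -
  interpret real_distribution std_normal_distribution by (rule real_dist_normal_dist)
  have "emeasure std_normal_distribution {..0} = (\<integral>\<^sup>+x. ennreal (std_normal_density x) * indicator {..0} x \<partial>lborel)"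
    by (subst emeasure_density) auto
  also have "\<dots> = ( \<integral>\<^sup>+x. ennreal (std_normal_density (0 + (-1) * x)) * indicator {..0} (0 + (-1) * x) \<partial>lborel)"
    by (subst nn_integral_real_affine[where c = "-1" and t = 0]) auto
  also have "\<dots> = (\<integral>\<^sup>+x. ennreal (std_normal_density x) * indicator {0..} x \<partial>lborel)"
    by (intro nn_integral_cong) (auto simp: indicator_def std_normal_density_def)
  also have "\<dots> = emeasure std_normal_distribution {0..}"
    by (subst emeasure_density) auto
  finally have eq: "measure std_normal_distribution {..0} = measure std_normal_distribution {0..}"
    by (simp add: measure_def)
  have "{0..} = {0::real} \<union> {0<..}" by auto
  hence "measure std_normal_distribution {0..} = measure std_normal_distribution {0<..}"
    using finite_measure_Union[of "{0}" "{0<..}"] by (simp add: measure_null_singleton_std_normal)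
  moreover have "measure std_normal_distribution {..0} + measure std_normal_distribution {0<..} = 1"
  proof -
    have "{..0} \<inter> {0<..} = ({} :: real set)" "{..0} \<union> {0<..} = (UNIV :: real set)" by auto
    thus ?thesis using prob_space finite_measure_Union[of "{..0}" "{0<..}"] by simp
  qed
  ultimately show ?thesis using eq by (simp add: cdf_def)
qed

text \<open>The density is positive everywhere, so the cdf is strictly below 1/2 to the left of 0; a
  negative quantile could not have cdf value \<open>p\<close>.\<close>

lemma std_normal_quantile_nonneg:
  assumes "1/2 \<le> p" "p < 1"
  shows "0 \<le> std_normal_quantile p"
proof -
  interpret real_distribution std_normal_distribution by (rule real_dist_normal_dist)
  define F where "F = cdf std_normal_distribution"
  have "eventually (\<lambda>y. p < F y) at_top"
    using cdf_lim_at_top_prob assms(2) unfolding F_def by (rule order_tendstoD)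
  then obtain y where y: "p < F y" "0 \<le> y"
    by (metis eventually_at_top_linorder linear order_refl)
  \<comment> \<open>\<open>inv F p\<close> is a genuine preimage only when \<open>p\<close> is
    attained. Continuity gives this between 0, where the cdf is 1/2, and \<open>y\<close>.\<close>
  have "\<exists>x\<ge>0. x \<le> y \<and> F x = p"
    using y assms isCont_cdf by (intro IVT) (auto simp: F_def cdf_std_normal_0 measure_null_singleton_std_normal)
  hence eq: "F (inv F p) = p"
    by (metis f_inv_into_f rangeI)
  show ?thesis
  proof (rule ccontr)
    assume neg: "\<not> 0 \<le> std_normal_quantile p"
    define q where "q = inv F p"
    have q: "q < 0" using neg by (simp add: q_def F_def std_normal_quantile_def)
    have "F q < F 0"
    proof -
      have "emeasure std_normal_distribution {q<..0} \<noteq> 0"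
      proof
        assume "emeasure std_normal_distribution {q<..0} = 0"
        hence "AE x in lborel. x \<notin> {q<..0}"
          by (subst (asm) emeasure_density)
             (auto simp: nn_integral_0_iff_AE indicator_def std_normal_density_def elim!: eventually_mono split: if_splits)
        hence "emeasure lborel {q<..0} = 0"
          by (subst (asm) AE_iff_measurable[where N = "{q<..0}"]) auto
        thus False using q by simp
      qed
      hence "0 < measure std_normal_distribution {q<..0}"
        by (simp add: emeasure_eq_measure zero_less_measure_iff)
      thus ?thesis using cdf_diff_eq[OF q] by (simp add: F_def)
    qed
    thus False using eq assms(1) by (simp add: q_def F_def cdf_std_normal_0)
  qed
qed

text \<open>Every point outside the support lies in a null set of a countable base, and the union of
  these base sets is still null.\<close>

lemma AE_in_topological_support:
  fixes P :: "'a::second_countable_topology measure"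
  assumes "sets P = sets borel"
  shows "AE x in P. x \<in> topological_support P"
proof -
  obtain B :: "'a set set" where B: "countable B" "topological_basis B"
    using ex_countable_basis by auto
  define N where "N = {U\<in>B. emeasure P U = 0}"
  have "AE x in P. \<forall>U\<in>N. x \<notin> U"
  proof (subst AE_ball_countable)
    show "countable N" using B(1) by (auto simp: N_def)
    show "\<forall>U\<in>N. AE x in P. x \<notin> U"
    proof
      fix U assume U: "U \<in> N"
      hence "U \<in> null_sets P"
        using topological_basis_open[OF B(2)] assms by (auto simp: N_def null_sets_def)
      thus "AE x in P. x \<notin> U" by (rule AE_not_in)
    qed
  qed
  thus ?thesis
  proof eventually_elim
    case (elim x)
    show ?case unfolding topological_support_def
    proof (safe, rule ccontr)
      fix U assume U: "open U" "x \<in> U" "\<not> 0 < emeasure P U"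
      then obtain V where V: "V \<in> B" "x \<in> V" "V \<subseteq> U"
        using topological_basisE[OF B(2)] by metis
      have "emeasure P V \<le> emeasure P U" using U assms V by (intro emeasure_mono) auto
      hence "V \<in> N" using U V by (auto simp: N_def)
      thus False using elim V by auto
    qed
  qed
qed

subsection \<open>Deterministic estimates for one round\<close>

definition choices :: "(real ^ 'k) set" where
  "choices = insert 0 (range (\<lambda>l. axis l 1))"

text \<open>The almost sure event on which all pathwise estimates rest: \<open>D\<close> will be a
  norm bound for the support of the coefficient law.\<close>

definition admissible :: "real \<Rightarrow> ('k::finite, 'm::finite) coeffs \<Rightarrow> bool" where
  "admissible D \<xi> \<longleftrightarrow> norm \<xi> \<le> D \<and> (\<forall>j. covariance_matrix (cov_coeff \<xi> j))"

text \<open>An l1 bound on the displacement \<open>A z - d\<close> of one round. The factor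
  \<open>1 / sqrt n\<close> of the Gaussian margin is bounded by 1 to make it uniform in
  \<open>n\<close>.\<close>

definition step_bound :: "real ^ 'm::finite \<Rightarrow> real \<Rightarrow> real \<Rightarrow> real" where
  "step_bound \<eta> D d_hi = (\<Sum>j\<in>UNIV. D + std_normal_quantile (\<eta> $ j) * sqrt D + d_hi)"

text \<open>
  Above the first summand the norm of the price does not increase, and from below it one
  update gains at most \<open>step_bound\<close>.
\<close>

definition price_bound :: "real ^ 'm::finite \<Rightarrow> real \<Rightarrow> real \<Rightarrow> real \<Rightarrow> real" where
  "price_bound \<eta> D d_lo d_hi =
     (D + (step_bound \<eta> D d_hi)\<^sup>2 / 2) / d_lo + step_bound \<eta> D d_hi"

definition violation_bound :: "real ^ 'm::finite \<Rightarrow> real \<Rightarrow> real \<Rightarrow> real \<Rightarrow> real" where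
  "violation_bound \<eta> D d_lo d_hi =
     (\<Sum>j\<in>UNIV. price_bound \<eta> D d_lo d_hi + std_normal_quantile (\<eta> $ j) * sqrt D)"

text \<open>The Lagrangian dual of the program with the adjusted matrices, restricted to one round.\<close>

definition dual_loss ::
  "real ^ 'm \<Rightarrow> nat \<Rightarrow> real ^ 'm \<Rightarrow> real ^ 'm \<Rightarrow> ('k::finite, 'm::finite) coeffs \<Rightarrow> real"
where
  "dual_loss \<eta> n b p \<xi> = (b /\<^sub>R real n) \<bullet> p + max 0 (Max (range (score \<eta> n p \<xi>)))"

section \<open>Binary decisions and bounds for admissible tuples\<close>

lemma finite_choices [simp]: "finite (choices :: (real ^ 'k::finite) set)"
  by (simp add: choices_def)

lemma zero_in_choices [simp]: "0 \<in> choices"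
  by (simp add: choices_def)

lemma choicesE:
  assumes "z \<in> choices"
  obtains "z = 0" | l where "z = axis l 1"
  using assms by (auto simp: choices_def)

text \<open>Two coordinates equal to 1 would already make \<open>1 \<bullet> z\<close> at least
  2.\<close>

lemma binary_in_choices:
  fixes z :: "real ^ 'k::finite"
  assumes "\<forall>l. z $ l \<in> {0, 1}" and "1 \<bullet> z \<le> 1"
  shows "z \<in> choices"
proof (cases "z = 0")
  case False
  then obtain l where l: "z $ l = 1" using assms(1) by (metis insertE singletonD vec_eq_iff zero_index)
  have "z $ i = 0" if "i \<noteq> l" for i
  proof (rule ccontr)
    assume "z $ i \<noteq> 0"
    hence "z $ i = 1" using assms(1) by auto
    hence "2 = (\<Sum>i\<in>{i, l}. z $ i)" using l that by simp
    also have "\<dots> \<le> (\<Sum>i\<in>UNIV. z $ i)"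
      using assms(1) by (intro sum_mono2) (auto, metis order.refl zero_le_one)
    also have "\<dots> = 1 \<bullet> z" by (simp add: inner_vec_def)
    finally show False using assms(2) by simp
  qed
  hence "z = axis l 1" using l by (auto simp: vec_eq_iff axis_def)
  thus ?thesis by (simp add: choices_def)
qed simp

lemma inner_axis_one: "(v :: real ^ 'k::finite) \<bullet> axis l 1 = v $ l"
  by (simp add: inner_axis)

lemma norm_choice_le: "z \<in> choices \<Longrightarrow> norm (z :: real ^ 'k::finite) \<le> 1"
  by (auto simp: choices_def)

context
  fixes D :: real and \<xi> :: "('k::finite, 'm::finite) coeffs"
  assumes adm: "admissible D \<xi>"
begin

lemma admissible_bound_nonneg: "0 \<le> D"
  using adm norm_ge_zero[of \<xi>] unfolding admissible_def by linarith

lemma norm_obj_coeff_le: "norm (obj_coeff \<xi>) \<le> D"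
  using adm norm_fst_le[of "fst \<xi>" "snd \<xi>"] by (simp add: admissible_def obj_coeff_def)

lemma norm_mean_coeff_le: "norm (mean_coeff \<xi> j) \<le> D"
proof -
  have "norm (mean_coeff \<xi> j) \<le> norm (fst (snd \<xi>))"
    by (simp add: mean_coeff_def Finite_Cartesian_Product.norm_nth_le)
  also have "\<dots> \<le> norm (snd \<xi>)" using norm_fst_le[of "fst (snd \<xi>)" "snd (snd \<xi>)"] by simp
  also have "\<dots> \<le> norm \<xi>" using norm_snd_le[of "snd \<xi>" "fst \<xi>"] by simp
  finally show ?thesis using adm by (simp add: admissible_def)
qed

lemma cov_diag_le: "cov_coeff \<xi> j $ l $ l \<le> D"
proof -
  have "cov_coeff \<xi> j $ l $ l \<le> norm (cov_coeff \<xi> j $ l)"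
    using component_le_norm_cart[of "cov_coeff \<xi> j $ l" l] by simp
  also have "\<dots> \<le> norm (cov_coeff \<xi> j)" by (rule Finite_Cartesian_Product.norm_nth_le)
  also have "\<dots> \<le> norm (snd (snd \<xi>))" by (simp add: cov_coeff_def Finite_Cartesian_Product.norm_nth_le)
  also have "\<dots> \<le> norm (snd \<xi>)" using norm_snd_le[of "snd (snd \<xi>)" "fst (snd \<xi>)"] by simp
  also have "\<dots> \<le> norm \<xi>" using norm_snd_le[of "snd \<xi>" "fst \<xi>"] by simp
  finally show ?thesis using adm by (simp add: admissible_def)
qed

lemma quadratic_form_axis: "axis l 1 \<bullet> ((K :: real ^ 'k ^ 'k) *v axis l 1) = K $ l $ l"
  by (simp add: inner_axis' matrix_vector_mult_basis column_def)

lemma cov_diag_nonneg: "0 \<le> cov_coeff \<xi> j $ l $ l"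
  using adm unfolding admissible_def covariance_matrix_def
  by (metis quadratic_form_axis)

text \<open>On a unit vector only one diagonal entry survives, so off-diagonal covariances are
  invisible to binary decisions. The diagonal is nonnegative, so squaring undoes its square
  root.\<close>

lemma quadratic_form_choice:
  assumes "z \<in> choices"
  shows "z \<bullet> (cov_coeff \<xi> j *v z) = (diag_sqrt (cov_coeff \<xi> j) \<bullet> z)\<^sup>2"
  using assms cov_diag_nonneg
  by (elim choicesE) (auto simp: quadratic_form_axis inner_axis_one diag_sqrt_def)

lemma diag_sqrt_choice_nonneg:
  assumes "z \<in> choices"
  shows "0 \<le> diag_sqrt (cov_coeff \<xi> j) \<bullet> z"
  using assms cov_diag_nonneg
  by (elim choicesE) (auto simp: inner_axis_one diag_sqrt_def)

lemma diag_sqrt_choice_le: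
  assumes "z \<in> choices"
  shows "diag_sqrt (cov_coeff \<xi> j) \<bullet> z \<le> sqrt D"
  using assms cov_diag_le admissible_bound_nonneg
  by (elim choicesE) (auto simp: inner_axis_one diag_sqrt_def)

lemma abs_obj_choice_le:
  assumes "z \<in> choices"
  shows "\<bar>obj_coeff \<xi> \<bullet> z\<bar> \<le> D"
proof -
  have "\<bar>obj_coeff \<xi> \<bullet> z\<bar> \<le> norm (obj_coeff \<xi>) * norm z" by (rule Cauchy_Schwarz_ineq2)
  also have "\<dots> \<le> D * 1"
    using norm_obj_coeff_le norm_choice_le[OF assms] by (intro mult_mono) (auto intro: admissible_bound_nonneg)
  finally show ?thesis by simp
qed

lemma abs_mean_choice_le:
  assumes "z \<in> choices"
  shows "\<bar>mean_coeff \<xi> j \<bullet> z\<bar> \<le> D"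
proof -
  have "\<bar>mean_coeff \<xi> j \<bullet> z\<bar> \<le> norm (mean_coeff \<xi> j) * norm z" by (rule Cauchy_Schwarz_ineq2)
  also have "\<dots> \<le> D * 1"
    using norm_mean_coeff_le norm_choice_le[OF assms] by (intro mult_mono) (auto intro: admissible_bound_nonneg)
  finally show ?thesis by simp
qed

end

section \<open>Optimality of the decision rule for the one-round Lagrangian\<close>

lemma adj_matrix_mult_nth:
  "(adj_matrix \<eta> n \<xi> *v z) $ j =
     mean_coeff \<xi> j \<bullet> z + std_normal_quantile (\<eta> $ j) / sqrt (real n) * (diag_sqrt (cov_coeff \<xi> j) \<bullet> z)"
  by (simp add: adj_matrix_def matrix_vector_mul_component inner_add_left)

lemma score_eq: "score \<eta> n p \<xi> l = obj_coeff \<xi> \<bullet> axis l 1 - p \<bullet> (adj_matrix \<eta> n \<xi> *v axis l 1)"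
  by (simp add: score_def inner_diff_left dot_lmul_matrix)

lemma set_pmf_opd_decision:
  "set_pmf (opd_decision \<eta> n p \<xi>) =
     (let v = Max (range (score \<eta> n p \<xi>)) in
      if v > 0 then (\<lambda>l. axis l 1) ` {l. v = score \<eta> n p \<xi> l} else {0})"
proof -
  \<comment> \<open>A maximiser exists, so \<open>pmf_of_set\<close> is applied to a nonempty
    set.\<close>
  have "Max (range (score \<eta> n p \<xi>)) \<in> range (score \<eta> n p \<xi>)" by (rule Max_in) auto
  hence "{l. Max (range (score \<eta> n p \<xi>)) = score \<eta> n p \<xi> l} \<noteq> {}" by blast
  thus ?thesis by (auto simp: opd_decision_def Let_def)
qed

lemma opd_decision_choices: "set_pmf (opd_decision \<eta> n p \<xi>) \<subseteq> choices"
  by (auto simp: set_pmf_opd_decision Let_def choices_def split: if_splits)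

text \<open>Every outcome of the tie-breaking has the same Lagrangian value, and by
  \<open>choice_value_le\<close> it is the largest over \<open>choices\<close>. Hence the later
  one-round estimates hold for each outcome, not merely on average.\<close>

lemma opd_decision_optimal:
  assumes "z \<in> set_pmf (opd_decision \<eta> n p \<xi>)"
  shows "obj_coeff \<xi> \<bullet> z - p \<bullet> (adj_matrix \<eta> n \<xi> *v z) = max 0 (Max (range (score \<eta> n p \<xi>)))"
  using assms by (auto simp: set_pmf_opd_decision Let_def score_eq split: if_splits)

lemma choice_value_le:
  assumes "z \<in> choices"
  shows "obj_coeff \<xi> \<bullet> z - p \<bullet> (adj_matrix \<eta> n \<xi> *v z) \<le> max 0 (Max (range (score \<eta> n p \<xi>)))"
  using assms
proof (cases rule: choicesE)
  case (2 l)
  have "score \<eta> n p \<xi> l \<le> Max (range (score \<eta> n p \<xi>))" by (rule Max_ge) auto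
  thus ?thesis using 2 score_eq[of \<eta> n p \<xi> l] by simp
qed simp

lemma dual_update_nonneg: "0 \<le> dual_update \<eta> n b p \<xi> z $ j"
  by (simp add: dual_update_def)

section \<open>Price dynamics for a fixed horizon and right-hand side\<close>

locale opd =
  fixes \<eta> :: "real ^ 'm::finite" and n :: nat and b :: "real ^ 'm" and D d_lo d_hi :: real
  assumes quantile_nonneg: "\<And>j. 0 \<le> std_normal_quantile (\<eta> $ j)"
    and n_pos: "1 \<le> n"
    and D_nonneg: "0 \<le> D"
    and d_lo_pos: "0 < d_lo"
    and b_lower: "\<And>j. d_lo \<le> b $ j / real n"
    and b_upper: "\<And>j. b $ j / real n \<le> d_hi"
begin

text \<open>Neither \<open>S\<close> nor \<open>B\<close> involves \<open>n\<close> or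
  \<open>b\<close>; this is what makes the final constant uniform.\<close>

abbreviation "S \<equiv> step_bound \<eta> D d_hi"
abbreviation "B \<equiv> price_bound \<eta> D d_lo d_hi"

lemma n_gt_0: "0 < real n" using n_pos by simp

lemma d_hi_pos: "0 < d_hi"
  using b_lower b_upper d_lo_pos by (meson less_le_trans order_trans)

lemma b_nonneg: "0 \<le> b $ j"
  using b_lower[of j] d_lo_pos n_gt_0 by (smt (verit) divide_nonpos_pos)

lemma S_nonneg: "0 \<le> S"
  unfolding step_bound_def using quantile_nonneg D_nonneg d_hi_pos by (intro sum_nonneg) auto

lemma norm_step_le:
  assumes "admissible D (\<xi> :: ('k::finite, 'm) coeffs)" "z \<in> choices"
  shows "norm (adj_matrix \<eta> n \<xi> *v z - b /\<^sub>R real n) \<le> S"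
proof -
  have "norm (adj_matrix \<eta> n \<xi> *v z - b /\<^sub>R real n)
      \<le> (\<Sum>j\<in>UNIV. \<bar>(adj_matrix \<eta> n \<xi> *v z - b /\<^sub>R real n) $ j\<bar>)" by (rule norm_le_l1_cart)
  also have "\<dots> \<le> S" unfolding step_bound_def
  proof (rule sum_mono)
    fix j :: 'm
    let ?q = "std_normal_quantile (\<eta> $ j)" and ?g = "diag_sqrt (cov_coeff \<xi> j) \<bullet> z"
    have "?q / sqrt (real n) \<le> ?q / 1"
      using n_pos quantile_nonneg by (intro divide_left_mono) auto
    hence "?q / sqrt (real n) * ?g \<le> ?q * sqrt D"
      using diag_sqrt_choice_nonneg[OF assms, of j] diag_sqrt_choice_le[OF assms, of j] quantile_nonneg[of j]
      by (intro mult_mono) auto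
    moreover have "0 \<le> ?q / sqrt (real n) * ?g"
      using diag_sqrt_choice_nonneg[OF assms, of j] quantile_nonneg[of j] by simp
    moreover have "0 \<le> b $ j / real n" using b_nonneg by simp
    ultimately show "\<bar>(adj_matrix \<eta> n \<xi> *v z - b /\<^sub>R real n) $ j\<bar> \<le> D + ?q * sqrt D + d_hi"
      using abs_mean_choice_le[OF assms, of j] b_upper[of j]
      by (simp add: adj_matrix_mult_nth divide_inverse mult.commute)
  qed
  finally show ?thesis .
qed

text \<open>Cutting at 0 never increases a component in absolute value, so it suffices to expand the
  square of the uncut step and to bound its quadratic term by \<open>S\<close>.\<close>

lemma norm_dual_update_sq_le:
  assumes "admissible D (\<xi> :: ('k::finite, 'm) coeffs)" "z \<in> choices"
  shows "(norm (dual_update \<eta> n b p \<xi> z))\<^sup>2 \<le>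
    (norm p)\<^sup>2 + 2 / sqrt (real n) * (p \<bullet> (adj_matrix \<eta> n \<xi> *v z) - (b /\<^sub>R real n) \<bullet> p) + S\<^sup>2 / real n"
proof -
  define u where "u = adj_matrix \<eta> n \<xi> *v z - b /\<^sub>R real n"
  have "norm (dual_update \<eta> n b p \<xi> z) \<le> norm (p + (1 / sqrt (real n)) *\<^sub>R u)"
    by (rule norm_le_componentwise_cart) (auto simp: dual_update_def u_def)
  hence "(norm (dual_update \<eta> n b p \<xi> z))\<^sup>2 \<le> (norm (p + (1 / sqrt (real n)) *\<^sub>R u))\<^sup>2"
    by (intro power_mono) auto
  also have "\<dots> = (norm p)\<^sup>2 + 2 / sqrt (real n) * (p \<bullet> u) + (norm u)\<^sup>2 / real n"
    by (simp add: power2_norm_eq_inner inner_add_left inner_add_right inner_commute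
        field_simps)
  also have "\<dots> \<le> (norm p)\<^sup>2 + 2 / sqrt (real n) * (p \<bullet> u) + S\<^sup>2 / real n"
    using norm_step_le[OF assms] by (intro add_left_mono divide_right_mono power_mono) (auto simp: u_def)
  finally show ?thesis by (simp add: u_def inner_diff_right inner_commute)
qed

text \<open>The weight \<open>sqrt n / 2\<close> turns the cross term of the expanded square into
  exactly \<open>p \<bullet> (A z) - d \<bullet> p\<close>, which is the gap between the reward of
  an optimal decision and the dual loss.\<close>

lemma one_step_progress:
  assumes "admissible D (\<xi> :: ('k::finite, 'm) coeffs)" "z \<in> set_pmf (opd_decision \<eta> n p \<xi>)"
  shows "dual_loss \<eta> n b p \<xi> - sqrt (real n) / 2 * (norm p)\<^sup>2 - S\<^sup>2 / (2 * sqrt (real n))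
     \<le> obj_coeff \<xi> \<bullet> z - sqrt (real n) / 2 * (norm (dual_update \<eta> n b p \<xi> z))\<^sup>2"
proof -
  define r where "r = sqrt (real n)"
  have r: "r > 0" "real n = r * r" using n_pos by (auto simp: r_def)
  have z: "z \<in> choices" using assms opd_decision_choices by blast
  have "r / 2 * (norm (dual_update \<eta> n b p \<xi> z))\<^sup>2 \<le>
     r / 2 * ((norm p)\<^sup>2 + 2 / r * (p \<bullet> (adj_matrix \<eta> n \<xi> *v z) - (b /\<^sub>R real n) \<bullet> p) + S\<^sup>2 / real n)"
    using norm_dual_update_sq_le[OF assms(1) z] r(1) by (intro mult_left_mono) (auto simp: r_def)
  also have "\<dots> = r / 2 * (norm p)\<^sup>2 + (p \<bullet> (adj_matrix \<eta> n \<xi> *v z) - (b /\<^sub>R real n) \<bullet> p) + S\<^sup>2 / (2 * r)"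
    unfolding r(2) using r(1) by (simp add: field_simps)
  finally show ?thesis
    using opd_decision_optimal[OF assms(2)] by (simp add: dual_loss_def flip: r_def)
qed

text \<open>The l2 norm is at most the l1 norm, which is linear on nonnegative prices.\<close>

lemma price_inner_lower:
  assumes "\<And>j. 0 \<le> p $ j"
  shows "d_lo * norm p \<le> (b /\<^sub>R real n) \<bullet> p"
proof -
  have "d_lo * norm p \<le> d_lo * (\<Sum>j\<in>UNIV. \<bar>p $ j\<bar>)"
    using d_lo_pos by (intro mult_left_mono norm_le_l1_cart) auto
  also have "\<dots> = (\<Sum>j\<in>UNIV. d_lo * p $ j)" using assms by (simp add: sum_distrib_left)
  also have "\<dots> \<le> (\<Sum>j\<in>UNIV. b $ j / real n * p $ j)"
    using b_lower assms by (intro sum_mono mult_right_mono) auto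
  also have "\<dots> = (b /\<^sub>R real n) \<bullet> p" by (simp add: inner_vec_def field_simps)
  finally show ?thesis .
qed

lemma price_bound_step:
  assumes "admissible D (\<xi> :: ('k::finite, 'm) coeffs)" "z \<in> set_pmf (opd_decision \<eta> n p \<xi>)"
    and p: "\<And>j. 0 \<le> p $ j" "norm p \<le> B"
  shows "norm (dual_update \<eta> n b p \<xi> z) \<le> B"
proof (cases "(D + S\<^sup>2 / 2) / d_lo \<le> norm p")
  case True
  have z: "z \<in> choices" using assms opd_decision_choices by blast
  have r: "1 \<le> sqrt (real n)" using n_pos by simp
  \<comment> \<open>The chosen decision has nonnegative Lagrangian value, so the priced consumption
    is at most its reward, hence at most \<open>D\<close>.\<close>
  have "p \<bullet> (adj_matrix \<eta> n \<xi> *v z) \<le> D"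
    using opd_decision_optimal[OF assms(2)] abs_obj_choice_le[OF assms(1) z] by linarith
  moreover have "D + S\<^sup>2 / 2 \<le> (b /\<^sub>R real n) \<bullet> p"
    using True d_lo_pos price_inner_lower[OF p(1)]
    by (simp only: pos_divide_le_eq) (simp add: mult.commute)
  ultimately have "2 / sqrt (real n) * (p \<bullet> (adj_matrix \<eta> n \<xi> *v z) - (b /\<^sub>R real n) \<bullet> p)
      \<le> 2 / sqrt (real n) * (- (S\<^sup>2 / 2))"
    using r by (intro mult_left_mono) auto
  also have "\<dots> = - (S\<^sup>2 / sqrt (real n))" by simp
  \<comment> \<open>The drift is of order \<open>1 / sqrt n\<close> and therefore absorbs the
    quadratic remainder \<open>S\<^sup>2 / n\<close>.\<close>
  also have "\<dots> \<le> - (S\<^sup>2 / real n)"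
  proof -
    have "sqrt (real n) * 1 \<le> sqrt (real n) * sqrt (real n)" using r by (intro mult_left_mono) auto
    hence "S\<^sup>2 / real n \<le> S\<^sup>2 / sqrt (real n)" using r n_gt_0 by (intro divide_left_mono) auto
    thus ?thesis by simp
  qed
  finally have "(norm (dual_update \<eta> n b p \<xi> z))\<^sup>2 \<le> (norm p)\<^sup>2"
    using norm_dual_update_sq_le[OF assms(1) z, of p] by linarith
  thus ?thesis using p(2) by (meson norm_ge_zero order_trans power2_le_imp_le)
next
  case False
  have z: "z \<in> choices" using assms opd_decision_choices by blast
  define u where "u = adj_matrix \<eta> n \<xi> *v z - b /\<^sub>R real n"
  have "norm (dual_update \<eta> n b p \<xi> z) \<le> norm (p + (1 / sqrt (real n)) *\<^sub>R u)"
    by (rule norm_le_componentwise_cart) (auto simp: dual_update_def u_def)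
  also have "\<dots> \<le> norm p + norm ((1 / sqrt (real n)) *\<^sub>R u)" by (rule norm_triangle_ineq)
  also have "norm ((1 / sqrt (real n)) *\<^sub>R u) \<le> 1 * S"
    unfolding norm_scaleR using norm_step_le[OF assms(1) z] n_pos
    by (intro mult_mono) (auto simp: u_def)
  finally show ?thesis using False by (simp add: price_bound_def)
qed

lemma B_nonneg: "0 \<le> B"
  unfolding price_bound_def using S_nonneg D_nonneg d_lo_pos by simp

text \<open>Forgetting the cut at 0 can only lower the new price. The scaling by
  \<open>sqrt n\<close> is chosen so that the inequality telescopes into the accumulated excess
  consumption.\<close>

lemma dual_update_ge:
  "sqrt (real n) * p $ j + ((adj_matrix \<eta> n \<xi> *v z) $ j - b $ j / real n)
     \<le> sqrt (real n) * dual_update \<eta> n b p (\<xi> :: ('k::finite, 'm) coeffs) z $ j"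
proof -
  let ?u = "(adj_matrix \<eta> n \<xi> *v z) $ j - b $ j / real n"
  have "sqrt (real n) * (p $ j + ?u / sqrt (real n)) \<le> sqrt (real n) * dual_update \<eta> n b p \<xi> z $ j"
    by (intro mult_left_mono) (auto simp: dual_update_def divide_inverse mult.commute)
  moreover have "sqrt (real n) * (p $ j + ?u / sqrt (real n)) = sqrt (real n) * p $ j + ?u"
    using n_gt_0 by (simp add: distrib_left)
  ultimately show ?thesis by simp
qed

section \<open>Conic constraints against adjusted linear constraints\<close>

text \<open>Cauchy--Schwarz: \<open>\<Sum>t. g t / sqrt n \<le> sqrt (\<Sum>t. (g t)\<^sup>2)\<close>.\<close>

lemma adjusted_le_socp_lhs:
  assumes adm: "\<And>t. t \<in> {1..n} \<Longrightarrow> admissible D (\<omega> t :: ('k::finite, 'm) coeffs)"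
    and x: "\<And>t. t \<in> {1..n} \<Longrightarrow> x t \<in> choices"
  shows "(\<Sum>t=1..n. (adj_matrix \<eta> n (\<omega> t) *v x t) $ j) \<le> socp_lhs \<eta> n \<omega> x $ j"
proof -
  define g where "g t = diag_sqrt (cov_coeff (\<omega> t) j) \<bullet> x t" for t
  have "(\<Sum>t=1..n. g t)\<^sup>2 \<le> real n * (\<Sum>t=1..n. (g t)\<^sup>2)"
    using Cauchy_Schwarz_ineq_sum[of "\<lambda>_. 1" g "{1..n}"] by simp
  hence "(\<Sum>t=1..n. g t) \<le> sqrt (real n * (\<Sum>t=1..n. (g t)\<^sup>2))" by (rule real_le_rsqrt)
  hence "(\<Sum>t=1..n. g t) / sqrt (real n) \<le> sqrt (\<Sum>t=1..n. (g t)\<^sup>2)"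
    using n_gt_0 by (simp add: real_sqrt_mult field_simps)
  hence "std_normal_quantile (\<eta> $ j) * ((\<Sum>t=1..n. g t) / sqrt (real n))
       \<le> std_normal_quantile (\<eta> $ j) * sqrt (\<Sum>t=1..n. (g t)\<^sup>2)"
    using quantile_nonneg by (intro mult_left_mono) auto
  moreover have "(\<Sum>t=1..n. x t \<bullet> (cov_coeff (\<omega> t) j *v x t)) = (\<Sum>t=1..n. (g t)\<^sup>2)"
    by (intro sum.cong refl) (simp add: g_def quadratic_form_choice[OF adm x])
  ultimately show ?thesis
    by (simp add: socp_lhs_def adj_matrix_mult_nth sum.distrib sum_distrib_left sum_divide_distrib flip: g_def)
qed

text \<open>A converse up to order \<open>sqrt n\<close>: each quadratic term is at most
  \<open>D\<close>, so the cone term is at most \<open>sqrt (D * n)\<close> times the quantile,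
  while the margins inside the adjusted matrix are nonnegative and may be added.\<close>

lemma socp_lhs_le_adjusted:
  assumes adm: "\<And>t. t \<in> {1..n} \<Longrightarrow> admissible D (\<omega> t :: ('k::finite, 'm) coeffs)"
    and x: "\<And>t. t \<in> {1..n} \<Longrightarrow> x t \<in> choices"
  shows "socp_lhs \<eta> n \<omega> x $ j \<le> (\<Sum>t=1..n. (adj_matrix \<eta> n (\<omega> t) *v x t) $ j)
     + std_normal_quantile (\<eta> $ j) * sqrt D * sqrt (real n)"
proof -
  define g where "g t = diag_sqrt (cov_coeff (\<omega> t) j) \<bullet> x t" for t
  have "(\<Sum>t=1..n. x t \<bullet> (cov_coeff (\<omega> t) j *v x t)) \<le> (\<Sum>t=1..n. D)"
  proof (rule sum_mono)
    fix t assume t: "t \<in> {1..n}"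
    have "(g t)\<^sup>2 \<le> (sqrt D)\<^sup>2" unfolding g_def
      by (intro power_mono diag_sqrt_choice_le[OF adm[OF t]] diag_sqrt_choice_nonneg[OF adm[OF t]] x t)
    thus "x t \<bullet> (cov_coeff (\<omega> t) j *v x t) \<le> D"
      using D_nonneg by (simp add: g_def quadratic_form_choice[OF adm[OF t] x[OF t]])
  qed
  hence "sqrt (\<Sum>t=1..n. x t \<bullet> (cov_coeff (\<omega> t) j *v x t)) \<le> sqrt D * sqrt (real n)"
    by (simp add: mult.commute flip: real_sqrt_mult)
  hence "std_normal_quantile (\<eta> $ j) * sqrt (\<Sum>t=1..n. x t \<bullet> (cov_coeff (\<omega> t) j *v x t))
    \<le> std_normal_quantile (\<eta> $ j) * (sqrt D * sqrt (real n))"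
    using quantile_nonneg by (intro mult_left_mono) auto
  moreover have "(\<Sum>t=1..n. mean_coeff (\<omega> t) j \<bullet> x t) \<le> (\<Sum>t=1..n. (adj_matrix \<eta> n (\<omega> t) *v x t) $ j)"
    unfolding adj_matrix_mult_nth
    using quantile_nonneg[of j] diag_sqrt_choice_nonneg[OF adm x] by (intro sum_mono) simp
  ultimately show ?thesis by (simp add: socp_lhs_def mult.assoc)
qed

section \<open>Weak duality and bounds for the optimal value\<close>

lemma isocp_feasible_choices:
  "x \<in> isocp_feasible \<eta> n b \<omega> \<Longrightarrow> t \<in> {1..n} \<Longrightarrow> x t \<in> choices"
  unfolding isocp_feasible_def by (auto intro!: binary_in_choices)

lemma zero_isocp_feasible: "(\<lambda>_. 0) \<in> isocp_feasible \<eta> n b \<omega>"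
  using b_nonneg by (simp add: isocp_feasible_def socp_lhs_def)

text \<open>Weak duality. Each reward is at most its priced consumption plus the maximal Lagrangian
  value. Conic feasibility implies the adjusted linear constraints, so nonnegative prices bound the
  total priced consumption by \<open>p \<bullet> b\<close>, which is split into \<open>n\<close>
  equal shares.\<close>

lemma objective_le_dual_loss:
  assumes adm: "\<And>t. t \<in> {1..n} \<Longrightarrow> admissible D (\<omega> t :: ('k::finite, 'm) coeffs)"
    and x: "x \<in> isocp_feasible \<eta> n b \<omega>" and p: "\<And>j. 0 \<le> p $ j"
  shows "objective n \<omega> x \<le> (\<Sum>t=1..n. dual_loss \<eta> n b p (\<omega> t))"
proof -
  have xc: "x t \<in> choices" if "t \<in> {1..n}" for t using isocp_feasible_choices[OF x that] .
  have "objective n \<omega> x \<le> (\<Sum>t=1..n. p \<bullet> (adj_matrix \<eta> n (\<omega> t) *v x t) + max 0 (Max (range (score \<eta> n p (\<omega> t)))))"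
    unfolding objective_def
  proof (intro sum_mono)
    fix t assume "t \<in> {1..n}"
    from choice_value_le[OF xc[OF this], of "\<omega> t" p \<eta> n]
    show "obj_coeff (\<omega> t) \<bullet> x t \<le> p \<bullet> (adj_matrix \<eta> n (\<omega> t) *v x t) + max 0 (Max (range (score \<eta> n p (\<omega> t))))"
      by linarith
  qed
  also have "\<dots> = p \<bullet> (\<Sum>t=1..n. adj_matrix \<eta> n (\<omega> t) *v x t) + (\<Sum>t=1..n. max 0 (Max (range (score \<eta> n p (\<omega> t)))))"
    by (simp add: sum.distrib inner_sum_right)
  also have "p \<bullet> (\<Sum>t=1..n. adj_matrix \<eta> n (\<omega> t) *v x t) \<le> p \<bullet> b"
    unfolding inner_vec_def
  proof (intro sum_mono)
    fix j
    have "(\<Sum>t=1..n. adj_matrix \<eta> n (\<omega> t) *v x t) $ j \<le> b $ j"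
      using adjusted_le_socp_lhs[of \<omega> x j, OF adm xc] x by (auto simp: isocp_feasible_def intro: order_trans)
    thus "p $ j \<bullet> (\<Sum>t=1..n. adj_matrix \<eta> n (\<omega> t) *v x t) $ j \<le> p $ j \<bullet> b $ j"
      using p by (simp add: mult_left_mono)
  qed
  also have "p \<bullet> b = (\<Sum>t=1..n. (b /\<^sub>R real n) \<bullet> p)"
    using n_gt_0 by (simp add: inner_commute)
  finally show ?thesis by (simp add: dual_loss_def sum.distrib)
qed

lemma isocp_value_le_dual_loss:
  assumes "\<And>t. t \<in> {1..n} \<Longrightarrow> admissible D (\<omega> t :: ('k::finite, 'm) coeffs)" and "\<And>j. 0 \<le> p $ j"
  shows "isocp_value \<eta> n b \<omega> \<le> (\<Sum>t=1..n. dual_loss \<eta> n b p (\<omega> t))"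
  unfolding isocp_value_def using zero_isocp_feasible assms
  by (intro cSUP_least objective_le_dual_loss) auto

lemma abs_objective_le:
  assumes "\<And>t. t \<in> {1..n} \<Longrightarrow> admissible D (\<omega> t :: ('k::finite, 'm) coeffs)"
    and "\<And>t. t \<in> {1..n} \<Longrightarrow> x t \<in> choices"
  shows "\<bar>objective n \<omega> x\<bar> \<le> real n * D"
proof -
  have "\<bar>objective n \<omega> x\<bar> \<le> (\<Sum>t=1..n. \<bar>obj_coeff (\<omega> t) \<bullet> x t\<bar>)"
    unfolding objective_def by (rule sum_abs)
  also have "\<dots> \<le> (\<Sum>t=1..n. D)" using assms by (intro sum_mono abs_obj_choice_le) auto
  finally show ?thesis by simp
qed

lemma abs_isocp_value_le:
  assumes adm: "\<And>t. t \<in> {1..n} \<Longrightarrow> admissible D (\<omega> t :: ('k::finite, 'm) coeffs)"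
  shows "\<bar>isocp_value \<eta> n b \<omega>\<bar> \<le> real n * D"
proof -
  have le: "objective n \<omega> x \<le> real n * D" if "x \<in> isocp_feasible \<eta> n b \<omega>" for x
    using abs_objective_le[of \<omega> x, OF adm isocp_feasible_choices[OF that]] by linarith
  have "objective n \<omega> (\<lambda>_. 0) \<le> isocp_value \<eta> n b \<omega>"
    unfolding isocp_value_def using le by (intro cSUP_upper zero_isocp_feasible) (auto simp: bdd_above_def)
  moreover have "isocp_value \<eta> n b \<omega> \<le> real n * D"
    unfolding isocp_value_def using zero_isocp_feasible le by (intro cSUP_least) auto
  ultimately show ?thesis by (simp add: objective_def)
qed

end

subsection \<open>The law of the algorithm over the tie-breaking\<close>

lemma expectation_mono_finite:
  fixes f g :: "'a \<Rightarrow> real"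
  assumes "finite (set_pmf M)" "\<And>a. a \<in> set_pmf M \<Longrightarrow> f a \<le> g a"
  shows "measure_pmf.expectation M f \<le> measure_pmf.expectation M g"
  using assms by (intro integral_mono_AE integrable_measure_pmf_finite) (auto simp: AE_measure_pmf_iff)

lemma expectation_ge_finite:
  fixes f :: "'a \<Rightarrow> real"
  assumes "finite (set_pmf M)" "\<And>a. a \<in> set_pmf M \<Longrightarrow> c \<le> f a"
  shows "c \<le> measure_pmf.expectation M f"
  using expectation_mono_finite[OF assms(1), of "\<lambda>_. c" f] assms(2) by simp

lemma expectation_le_finite:
  fixes f :: "'a \<Rightarrow> real"
  assumes "finite (set_pmf M)" "\<And>a. a \<in> set_pmf M \<Longrightarrow> f a \<le> c"
  shows "measure_pmf.expectation M f \<le> c"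
  using expectation_mono_finite[OF assms(1), of f "\<lambda>_. c"] assms(2) by simp

lemma abs_expectation_le_finite:
  fixes f :: "'a \<Rightarrow> real"
  assumes "finite (set_pmf M)" "\<And>a. a \<in> set_pmf M \<Longrightarrow> \<bar>f a\<bar> \<le> c"
  shows "\<bar>measure_pmf.expectation M f\<bar> \<le> c"
  using expectation_le_finite[OF assms(1), of f c] expectation_ge_finite[OF assms(1), of "- c" f] assms(2)
  by (simp add: abs_le_iff) (meson minus_le_iff)

section \<open>Finite support and recursion of the state\<close>

lemma finite_opd_decision: "finite (set_pmf (opd_decision \<eta> n p \<xi>))"
  using finite_subset[OF opd_decision_choices finite_choices] .

lemma finite_opd_state: "finite (set_pmf (opd_state \<eta> n b \<omega> t))"
  by (induction t) (auto simp: finite_opd_decision)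

text \<open>The algorithm is non-anticipating. This is what later allows the next tuple to be
  integrated while the price is held fixed.\<close>

lemma opd_state_cong:
  assumes "\<And>i. i \<in> {1..t} \<Longrightarrow> \<omega> i = \<omega>' i"
  shows "opd_state \<eta> n b \<omega> t = opd_state \<eta> n b \<omega>' t"
  using assms
proof (induction t)
  case (Suc t)
  hence "opd_state \<eta> n b \<omega> t = opd_state \<eta> n b \<omega>' t" by simp
  thus ?case using Suc.prems[of "Suc t"] by simp
qed simp

lemma opd_state_choices:
  "s \<in> set_pmf (opd_state \<eta> n b \<omega> t) \<Longrightarrow> fst s i \<in> choices"
proof (induction t arbitrary: s)
  case (Suc t)
  then obtain s' z where "s' \<in> set_pmf (opd_state \<eta> n b \<omega> t)"
    and "z \<in> set_pmf (opd_decision \<eta> n (snd s') (\<omega> (Suc t)))"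
    and "fst s = (fst s')(Suc t := z)"
    by auto
  thus ?case using Suc.IH[of s'] subsetD[OF opd_decision_choices] by (cases "i = Suc t") simp_all
qed simp

lemma opd_state_price_nonneg:
  "s \<in> set_pmf (opd_state \<eta> n b \<omega> t) \<Longrightarrow> 0 \<le> snd s $ j"
  by (cases t) (auto simp: dual_update_nonneg)

text \<open>Tower property for one round; finite supports make it valid for arbitrary real
  \<open>G\<close>.\<close>

lemma expectation_opd_state_Suc:
  fixes G :: "_ \<Rightarrow> real"
  shows "measure_pmf.expectation (opd_state \<eta> n b \<omega> (Suc t)) G =
    measure_pmf.expectation (opd_state \<eta> n b \<omega> t) (\<lambda>s.
      measure_pmf.expectation (opd_decision \<eta> n (snd s) (\<omega> (Suc t)))
        (\<lambda>z. G ((fst s)(Suc t := z), dual_update \<eta> n b (snd s) (\<omega> (Suc t)) z)))"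
proof -
  define H where "H s = measure_pmf.expectation (opd_decision \<eta> n (snd s) (\<omega> (Suc t)))
        (\<lambda>z. G ((fst s)(Suc t := z), dual_update \<eta> n b (snd s) (\<omega> (Suc t)) z))" for s
  have "measure_pmf.expectation (opd_state \<eta> n b \<omega> (Suc t)) G =
     (\<Sum>s\<in>set_pmf (opd_state \<eta> n b \<omega> t). pmf (opd_state \<eta> n b \<omega> t) s *\<^sub>R H s)"
    unfolding opd_state.simps
    by (subst pmf_expectation_bind[OF finite_opd_state _ subset_refl])
       (auto simp: finite_opd_decision case_prod_unfold H_def)
  also have "\<dots> = measure_pmf.expectation (opd_state \<eta> n b \<omega> t) H"
    by (rule integral_measure_pmf[OF finite_opd_state, symmetric])
  finally show ?thesis unfolding H_def .
qed

section \<open>Measurability in the sample and the price\<close>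

lemma pmf_opd_decision_zero:
  "pmf (opd_decision \<eta> n p \<xi>) 0 = (if 0 < Max (range (score \<eta> n p \<xi>)) then 0 else 1)"
  by (auto simp: pmf_eq_0_set_pmf set_pmf_opd_decision Let_def axis_eq_0_iff)
     (simp add: opd_decision_def)

text \<open>The number of maximisers is written as a sum of indicators, so that measurability in
  price and coefficients can be read off.\<close>

lemma pmf_opd_decision_axis:
  "pmf (opd_decision \<eta> n p \<xi>) (axis l 1) =
    (let v = Max (range (score \<eta> n p \<xi>)) in
     if 0 < v \<and> v = score \<eta> n p \<xi> l then 1 / (\<Sum>i\<in>UNIV. if v = score \<eta> n p \<xi> i then 1 else 0) else 0)"
proof -
  define v where "v = Max (range (score \<eta> n p \<xi>))"
  have "v \<in> range (score \<eta> n p \<xi>)" unfolding v_def by (rule Max_in) auto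
  hence ne: "{l. v = score \<eta> n p \<xi> l} \<noteq> {}" by blast
  have inj: "inj (\<lambda>l. axis l 1 :: real ^ 'a)" by (auto simp: inj_on_def axis_eq_axis)
  have card: "real (card {l. v = score \<eta> n p \<xi> l}) = (\<Sum>i\<in>UNIV. if v = score \<eta> n p \<xi> i then 1 else 0)"
    by (simp add: sum.If_cases)
  show ?thesis
    unfolding opd_decision_def v_def[symmetric] Let_def card[symmetric]
    using pmf_map_inj'[OF inj, of "pmf_of_set {l. v = score \<eta> n p \<xi> l}" l] ne
    by (auto simp: indicator_def axis_eq_0_iff)
qed

lemma measurable_obj_coeff [measurable]: "obj_coeff \<in> borel_measurable borel"
  unfolding obj_coeff_def by (intro borel_measurable_continuous_onI continuous_intros)

lemma measurable_mean_coeff [measurable]: "(\<lambda>\<xi>. mean_coeff \<xi> j) \<in> borel_measurable borel"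
  unfolding mean_coeff_def by (intro borel_measurable_continuous_onI continuous_intros)

lemma measurable_cov_diag [measurable]: "(\<lambda>\<xi>. cov_coeff \<xi> j $ l $ i) \<in> borel_measurable borel"
  unfolding cov_coeff_def by (intro borel_measurable_continuous_onI continuous_intros)

lemma measurable_diag_sqrt [measurable]:
  "(\<lambda>\<xi>. diag_sqrt (cov_coeff \<xi> j) \<bullet> z) \<in> borel_measurable borel"
  unfolding diag_sqrt_def inner_vec_def by simp

lemma measurable_adj_matrix_mult [measurable]:
  "(\<lambda>\<xi>. (adj_matrix \<eta> n \<xi> *v z) $ j) \<in> borel_measurable borel"
  unfolding adj_matrix_mult_nth by simp

lemma measurable_vec_nth [measurable]: "(\<lambda>p :: real ^ 'a. p $ j) \<in> borel_measurable borel"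
  by (intro borel_measurable_continuous_onI continuous_intros)

lemma measurable_vec_lambda:
  fixes f :: "'a \<Rightarrow> real ^ 'b::finite"
  assumes "\<And>j. (\<lambda>x. f x $ j) \<in> borel_measurable M"
  shows "f \<in> borel_measurable M"
  unfolding borel_measurable_euclidean_space[of f]
  using assms by (auto simp: Basis_vec_def inner_axis)

lemma measurable_score [measurable]:
  "(\<lambda>q. score \<eta> n (fst q) (snd q) l) \<in> borel_measurable (borel \<Otimes>\<^sub>M borel)"
  unfolding score_eq inner_vec_def[of _ "adj_matrix _ _ _ *v _"] by simp

lemma measurable_Max_score [measurable]:
  "(\<lambda>q. Max (range (score \<eta> n (fst q) (snd q)))) \<in> borel_measurable (borel \<Otimes>\<^sub>M borel)"
  by (intro borel_measurable_Max) auto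

lemma measurable_dual_loss:
  "(\<lambda>q. dual_loss \<eta> n b (fst q) (snd q)) \<in> borel_measurable (borel \<Otimes>\<^sub>M borel)"
  unfolding dual_loss_def by measurable

lemma measurable_dual_update:
  "(\<lambda>q. dual_update \<eta> n b (fst q) (snd q) z) \<in> borel_measurable (borel \<Otimes>\<^sub>M borel)"
  by (rule measurable_vec_lambda) (simp add: dual_update_def)

lemma measurable_pmf_opd_decision:
  assumes "z \<in> choices"
  shows "(\<lambda>q. pmf (opd_decision \<eta> n (fst q) (snd q)) z) \<in> borel_measurable (borel \<Otimes>\<^sub>M borel)"
  using assms
proof (cases rule: choicesE)
  case 1
  show ?thesis unfolding 1 pmf_opd_decision_zero by measurable
next
  case (2 l)
  show ?thesis unfolding 2 pmf_opd_decision_axis Let_def by measurable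
qed

text \<open>The induction integrates out the last round and absorbs it into \<open>G\<close>, hence
  the generalisation over \<open>G\<close>. Decision histories carry no sigma-algebra: they enter as
  a parameter \<open>x\<close>, with one joint measurability condition in sample and price for
  each.\<close>

lemma measurable_expectation_opd_state:
  fixes P :: "('k::finite, 'm::finite) coeffs measure"
  assumes P: "sets P = sets borel" and "t \<le> n"
    and "\<And>x. (\<lambda>q. G (fst q) (x, snd q)) \<in> borel_measurable (PiM {1..n} (\<lambda>_. P) \<Otimes>\<^sub>M borel)"
  shows "(\<lambda>\<omega>. measure_pmf.expectation (opd_state \<eta> n b \<omega> t) (G \<omega>) :: real) \<in> borel_measurable (PiM {1..n} (\<lambda>_. P))"
  using assms(2,3)
proof (induction t arbitrary: G)
  case 0
  let ?N = "PiM {1..n} (\<lambda>_. P)"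
  have "(\<lambda>\<omega>. (\<omega>, 0)) \<in> measurable ?N (?N \<Otimes>\<^sub>M borel)" by simp
  from measurable_compose[OF this "0.prems"(2)[of "\<lambda>_. 0"]] show ?case by simp
next
  case (Suc t)
  let ?N = "PiM {1..n} (\<lambda>_. P)"
  have comp: "(\<lambda>q. fst q (Suc t)) \<in> measurable (?N \<Otimes>\<^sub>M borel) borel"
  proof -
    have "(\<lambda>\<omega>. \<omega> (Suc t)) \<in> measurable ?N P" using Suc.prems(1) by (intro measurable_component_singleton) auto
    hence "(\<lambda>\<omega>. \<omega> (Suc t)) \<in> measurable ?N borel"
      by (subst measurable_cong_sets[OF refl P[symmetric]])
    from measurable_compose[OF measurable_fst this] show ?thesis .
  qed
  have pair: "(\<lambda>q. (snd q, fst q (Suc t))) \<in> measurable (?N \<Otimes>\<^sub>M borel) (borel \<Otimes>\<^sub>M borel)"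
    using comp by (intro measurable_Pair measurable_snd)
  \<comment> \<open>The support of the decision varies with price and sample, but lies in the fixed
    finite set \<open>choices\<close>; the inner expectation becomes a sum with constant index
    set.\<close>
  have "measure_pmf.expectation (opd_state \<eta> n b \<omega> (Suc t)) (G \<omega>) =
    measure_pmf.expectation (opd_state \<eta> n b \<omega> t) (\<lambda>s.
      \<Sum>z\<in>choices. pmf (opd_decision \<eta> n (snd s) (\<omega> (Suc t))) z *
        G \<omega> ((fst s)(Suc t := z), dual_update \<eta> n b (snd s) (\<omega> (Suc t)) z))" for \<omega>
    unfolding expectation_opd_state_Suc
    by (subst integral_measure_pmf[OF finite_choices]) (auto intro: subsetD[OF opd_decision_choices])
  moreover have "(\<lambda>\<omega>. measure_pmf.expectation (opd_state \<eta> n b \<omega> t) (\<lambda>s.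
      \<Sum>z\<in>choices. pmf (opd_decision \<eta> n (snd s) (\<omega> (Suc t))) z *
        G \<omega> ((fst s)(Suc t := z), dual_update \<eta> n b (snd s) (\<omega> (Suc t)) z))) \<in> borel_measurable ?N"
  proof (rule Suc.IH)
    fix x :: "nat \<Rightarrow> real ^ 'k"
    show "(\<lambda>q. \<Sum>z\<in>choices. pmf (opd_decision \<eta> n (snd (x, snd q)) (fst q (Suc t))) z *
        G (fst q) ((fst (x, snd q))(Suc t := z), dual_update \<eta> n b (snd (x, snd q)) (fst q (Suc t)) z))
      \<in> borel_measurable (?N \<Otimes>\<^sub>M borel)"
      unfolding fst_conv snd_conv
    proof (intro borel_measurable_sum borel_measurable_times)
      fix z :: "real ^ 'k" assume z: "z \<in> choices"
      show "(\<lambda>q. pmf (opd_decision \<eta> n (snd q) (fst q (Suc t))) z) \<in> borel_measurable (?N \<Otimes>\<^sub>M borel)"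
        using measurable_compose[OF pair measurable_pmf_opd_decision[OF z]] by simp
      have "(\<lambda>q. (fst q, dual_update \<eta> n b (snd q) (fst q (Suc t)) z)) \<in> measurable (?N \<Otimes>\<^sub>M borel) (?N \<Otimes>\<^sub>M borel)"
        using measurable_compose[OF pair measurable_dual_update] by (intro measurable_Pair measurable_fst) simp
      from measurable_compose[OF this Suc.prems(2)[of "x(Suc t := z)"]]
      show "(\<lambda>q. G (fst q) (x(Suc t := z), dual_update \<eta> n b (snd q) (fst q (Suc t)) z)) \<in> borel_measurable (?N \<Otimes>\<^sub>M borel)"
        by (simp only: fst_conv snd_conv)
    qed
  qed (use Suc.prems in simp)
  ultimately show ?case by simp
qed

lemma measurable_sample_component:
  assumes "sets P = sets borel" "t \<in> I"
  shows "(\<lambda>\<omega>. \<omega> t) \<in> measurable (PiM I (\<lambda>_. P)) borel"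
  using measurable_component_singleton[OF assms(2), of "\<lambda>_. P"]
  by (subst measurable_cong_sets[OF refl assms(1)[symmetric]])

lemma quadratic_form_sum:
  "x \<bullet> ((K :: real ^ 'k ^ 'k::finite) *v x) = (\<Sum>i\<in>UNIV. \<Sum>l\<in>UNIV. x $ i * (K $ i $ l * x $ l))"
  by (simp add: inner_vec_def matrix_vector_mult_def sum_distrib_left)

lemma measurable_socp_lhs:
  fixes P :: "('k::finite, 'm::finite) coeffs measure"
  assumes P: "sets P = sets borel"
  shows "(\<lambda>\<omega>. socp_lhs \<eta> n \<omega> x $ j) \<in> borel_measurable (PiM {1..n} (\<lambda>_. P))"
proof -
  have [measurable]: "(\<lambda>\<omega>. mean_coeff (\<omega> t) j \<bullet> x t) \<in> borel_measurable (PiM {1..n} (\<lambda>_. P))"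
    "(\<lambda>\<omega>. x t \<bullet> (cov_coeff (\<omega> t) j *v x t)) \<in> borel_measurable (PiM {1..n} (\<lambda>_. P))"
    if t: "t \<in> {1..n}" for t
  proof -
    note [measurable] = measurable_sample_component[OF P t]
    show "(\<lambda>\<omega>. mean_coeff (\<omega> t) j \<bullet> x t) \<in> borel_measurable (PiM {1..n} (\<lambda>_. P))"
      by measurable
    show "(\<lambda>\<omega>. x t \<bullet> (cov_coeff (\<omega> t) j *v x t)) \<in> borel_measurable (PiM {1..n} (\<lambda>_. P))"
      unfolding quadratic_form_sum by measurable
  qed
  show ?thesis unfolding socp_lhs_def vec_lambda_beta by measurable
qed

lemma measurable_objective:
  fixes P :: "('k::finite, 'm::finite) coeffs measure"
  assumes P: "sets P = sets borel"
  shows "(\<lambda>\<omega>. objective n \<omega> x) \<in> borel_measurable (PiM {1..n} (\<lambda>_. P))"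
  unfolding objective_def
proof (intro borel_measurable_sum)
  fix t assume t: "t \<in> {1..n}"
  note [measurable] = measurable_sample_component[OF P t]
  show "(\<lambda>\<omega>. obj_coeff (\<omega> t) \<bullet> x t) \<in> borel_measurable (PiM {1..n} (\<lambda>_. P))" by measurable
qed

lemma measurable_violation:
  fixes P :: "('k::finite, 'm::finite) coeffs measure"
  assumes P: "sets P = sets borel"
  shows "(\<lambda>\<omega>. violation \<eta> n b \<omega> x) \<in> borel_measurable (PiM {1..n} (\<lambda>_. P))"
  unfolding violation_def
proof (intro measurable_compose[OF _ borel_measurable_norm] measurable_vec_lambda)
  show "(\<lambda>\<omega>. (\<chi> j. max ((socp_lhs \<eta> n \<omega> x - b) $ j) 0) $ j) \<in> borel_measurable (PiM {1..n} (\<lambda>_. P))" for j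
    unfolding vec_lambda_beta vector_minus_component
    by (intro borel_measurable_max borel_measurable_diff measurable_socp_lhs[OF P] borel_measurable_const)
qed

context opd
begin

text \<open>Written for measurability: the feasible set varies with \<open>\<omega>\<close> and
  leaves \<open>x\<close> free outside \<open>{1..n}\<close>, whereas this maximum runs over a fixed
  finite set. Scoring infeasible points 0 is harmless because the zero decision is feasible with
  objective 0.\<close>

lemma isocp_value_eq_Max:
  "isocp_value \<eta> n b (\<omega> :: nat \<Rightarrow> ('k::finite, 'm) coeffs) =
    Max ((\<lambda>x. if x \<in> isocp_feasible \<eta> n b \<omega> then objective n \<omega> x else 0) ` ({1..n} \<rightarrow>\<^sub>E choices))"
proof -
  define F :: "(nat \<Rightarrow> real ^ 'k) set" where "F = {1..n} \<rightarrow>\<^sub>E choices"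
  define f where "f x = (if x \<in> isocp_feasible \<eta> n b \<omega> then objective n \<omega> x else 0)" for x
  have fin: "finite (f ` F)" unfolding F_def by (intro finite_imageI finite_PiE) auto
  have objective_cong: "objective n \<omega> (restrict x {1..n}) = objective n \<omega> x" for x
    unfolding objective_def by (intro sum.cong refl) simp
  have lhs_cong: "socp_lhs \<eta> n \<omega> (restrict x {1..n}) = socp_lhs \<eta> n \<omega> x" for x
  proof -
    have "(\<Sum>t=1..n. mean_coeff (\<omega> t) j \<bullet> restrict x {1..n} t) = (\<Sum>t=1..n. mean_coeff (\<omega> t) j \<bullet> x t)"
      "(\<Sum>t=1..n. restrict x {1..n} t \<bullet> (cov_coeff (\<omega> t) j *v restrict x {1..n} t)) =
       (\<Sum>t=1..n. x t \<bullet> (cov_coeff (\<omega> t) j *v x t))" for j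
      by (intro sum.cong refl; simp)+
    thus ?thesis unfolding socp_lhs_def by (simp only:)
  qed
  have le: "objective n \<omega> x \<le> Max (f ` F)" if x: "x \<in> isocp_feasible \<eta> n b \<omega>" for x
  proof -
    let ?y = "restrict x {1..n}"
    have "?y \<in> isocp_feasible \<eta> n b \<omega>"
      using x unfolding isocp_feasible_def mem_Collect_eq lhs_cong by simp
    hence "objective n \<omega> x = f ?y" unfolding f_def objective_cong by simp
    also have "?y \<in> F" using isocp_feasible_choices[OF x] unfolding F_def by (intro restrict_PiE_iff[THEN iffD2]) blast
    hence "f ?y \<le> Max (f ` F)" by (intro Max_ge fin imageI)
    finally show ?thesis .
  qed
  have bdd: "bdd_above (objective n \<omega> ` isocp_feasible \<eta> n b \<omega>)"
    using le by (intro bdd_aboveI2)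
  have f_le: "f x \<le> isocp_value \<eta> n b \<omega>" for x
    using cSUP_upper[OF _ bdd, of x] cSUP_upper[OF zero_isocp_feasible bdd]
    unfolding isocp_value_def f_def by (cases "x \<in> isocp_feasible \<eta> n b \<omega>") (simp_all add: objective_def)
  have "F \<noteq> {}" unfolding F_def by (simp add: PiE_eq_empty_iff choices_def)
  hence "Max (f ` F) \<in> f ` F" by (intro Max_in fin) simp
  hence "Max (f ` F) \<le> isocp_value \<eta> n b \<omega>" using f_le by (elim imageE) simp
  moreover have "isocp_value \<eta> n b \<omega> \<le> Max (f ` F)"
    unfolding isocp_value_def by (intro cSUP_least le) (use zero_isocp_feasible in blast)
  ultimately show ?thesis unfolding f_def F_def by (rule antisym[rotated])
qed

lemma measurable_isocp_value:
  fixes P :: "('k::finite, 'm) coeffs measure"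
  assumes P: "sets P = sets borel"
  shows "isocp_value \<eta> n b \<in> borel_measurable (PiM {1..n} (\<lambda>_. P))"
  unfolding isocp_value_eq_Max[abs_def]
proof (intro borel_measurable_Max finite_PiE)
  fix x :: "nat \<Rightarrow> real ^ 'k"
  note [measurable] = measurable_socp_lhs[OF P] measurable_objective[OF P]
  show "(\<lambda>\<omega>. if x \<in> isocp_feasible \<eta> n b \<omega> then objective n \<omega> x else 0) \<in> borel_measurable (PiM {1..n} (\<lambda>_. P))"
    unfolding isocp_feasible_def mem_Collect_eq by measurable
qed auto

section \<open>Guarantees along a run: prices, violation, progress\<close>

lemma opd_state_price_le:
  assumes "\<And>i. i \<in> {1..n} \<Longrightarrow> admissible D (\<omega> i :: ('k::finite, 'm) coeffs)" "t \<le> n"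
    "s \<in> set_pmf (opd_state \<eta> n b \<omega> t)"
  shows "norm (snd s) \<le> B"
  using assms(2,3)
proof (induction t arbitrary: s)
  case (Suc t)
  then obtain s' z where s': "s' \<in> set_pmf (opd_state \<eta> n b \<omega> t)"
    and z: "z \<in> set_pmf (opd_decision \<eta> n (snd s') (\<omega> (Suc t)))"
    and s: "s = ((fst s')(Suc t := z), dual_update \<eta> n b (snd s') (\<omega> (Suc t)) z)"
    by auto
  show ?case unfolding s snd_conv
    using Suc s' by (intro price_bound_step[OF _ z]) (auto intro: opd_state_price_nonneg assms(1))
qed (use B_nonneg in simp)

text \<open>\<open>dual_update_ge\<close> telescopes, starting from the zero price.\<close>

lemma opd_state_excess_le:
  assumes "s \<in> set_pmf (opd_state \<eta> n b \<omega> t)"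
  shows "(\<Sum>i=1..t. (adj_matrix \<eta> n (\<omega> i :: ('k::finite, 'm) coeffs) *v fst s i) $ j - b $ j / real n)
     \<le> sqrt (real n) * snd s $ j"
  using assms
proof (induction t arbitrary: s)
  case (Suc t)
  then obtain s' z where s': "s' \<in> set_pmf (opd_state \<eta> n b \<omega> t)"
    and s: "s = ((fst s')(Suc t := z), dual_update \<eta> n b (snd s') (\<omega> (Suc t)) z)"
    by auto
  have "(\<Sum>i=1..t. (adj_matrix \<eta> n (\<omega> i) *v fst s i) $ j - b $ j / real n) =
      (\<Sum>i=1..t. (adj_matrix \<eta> n (\<omega> i) *v fst s' i) $ j - b $ j / real n)"
    by (intro sum.cong refl) (simp add: s)
  moreover have "fst s (Suc t) = z" and "snd s = dual_update \<eta> n b (snd s') (\<omega> (Suc t)) z"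
    by (simp_all add: s)
  ultimately show ?case
    using Suc.IH[OF s'] dual_update_ge[of "snd s'" j "\<omega> (Suc t)" z]
    by (simp only: sum.nat_ivl_Suc')
qed simp

text \<open>Each coordinate is charged twice: the excess of the linear constraints is at most
  \<open>sqrt n * B\<close>, and passing from linear to conic constraints costs another multiple of
  \<open>sqrt n\<close>.\<close>

lemma violation_le:
  assumes adm: "\<And>i. i \<in> {1..n} \<Longrightarrow> admissible D (\<omega> i :: ('k::finite, 'm) coeffs)"
    and s: "s \<in> set_pmf (opd_state \<eta> n b \<omega> n)"
  shows "violation \<eta> n b \<omega> (fst s) \<le> violation_bound \<eta> D d_lo d_hi * sqrt (real n)"
proof -
  have "violation \<eta> n b \<omega> (fst s) \<le> (\<Sum>j\<in>UNIV. \<bar>(\<chi> j. max ((socp_lhs \<eta> n \<omega> (fst s) - b) $ j) 0) $ j\<bar>)"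
    unfolding violation_def by (rule norm_le_l1_cart)
  also have "\<dots> \<le> (\<Sum>j\<in>UNIV. (B + std_normal_quantile (\<eta> $ j) * sqrt D) * sqrt (real n))"
  proof (rule sum_mono)
    fix j
    have "socp_lhs \<eta> n \<omega> (fst s) $ j - b $ j \<le>
       (\<Sum>i=1..n. (adj_matrix \<eta> n (\<omega> i) *v fst s i) $ j - b $ j / real n) + std_normal_quantile (\<eta> $ j) * sqrt D * sqrt (real n)"
      using socp_lhs_le_adjusted[of \<omega> "fst s" j, OF adm opd_state_choices[OF s]] n_gt_0
      by (simp add: sum_subtractf)
    also have "\<dots> \<le> sqrt (real n) * snd s $ j + std_normal_quantile (\<eta> $ j) * sqrt D * sqrt (real n)"
      using opd_state_excess_le[OF s] by simp
    also have "sqrt (real n) * snd s $ j \<le> sqrt (real n) * B"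
      using component_le_norm_cart[of "snd s" j] opd_state_price_le[OF adm order_refl s]
      by (intro mult_left_mono) auto
    finally have "socp_lhs \<eta> n \<omega> (fst s) $ j - b $ j \<le> (B + std_normal_quantile (\<eta> $ j) * sqrt D) * sqrt (real n)"
      by (simp add: algebra_simps)
    moreover have "0 \<le> (B + std_normal_quantile (\<eta> $ j) * sqrt D) * sqrt (real n)"
      using B_nonneg quantile_nonneg D_nonneg by simp
    ultimately show "\<bar>(\<chi> j. max ((socp_lhs \<eta> n \<omega> (fst s) - b) $ j) 0) $ j\<bar>
       \<le> (B + std_normal_quantile (\<eta> $ j) * sqrt D) * sqrt (real n)" by simp
  qed
  finally show ?thesis by (simp add: violation_bound_def sum_distrib_right)
qed

text \<open>\<open>one_step_progress\<close> averaged over the tie-breaking and summed, with a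
  potential that starts at 0. The state after round \<open>i\<close> holds the price used in round
  \<open>Suc i\<close>, hence the index shift in the dual loss.\<close>

lemma expected_progress:
  assumes adm: "\<And>i. i \<in> {1..n} \<Longrightarrow> admissible D (\<omega> i :: ('k::finite, 'm) coeffs)" and "t \<le> n"
  shows "(\<Sum>i<t. measure_pmf.expectation (opd_state \<eta> n b \<omega> i) (\<lambda>s. dual_loss \<eta> n b (snd s) (\<omega> (Suc i))))
      - real t * (S\<^sup>2 / (2 * sqrt (real n)))
    \<le> measure_pmf.expectation (opd_state \<eta> n b \<omega> t)
         (\<lambda>s. (\<Sum>i=1..t. obj_coeff (\<omega> i) \<bullet> fst s i) - sqrt (real n) / 2 * (norm (snd s))\<^sup>2)"
  using assms(2)
proof (induction t)
  case (Suc t)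
  define V where "V t s = (\<Sum>i=1..t. obj_coeff (\<omega> i) \<bullet> fst s i) - sqrt (real n) / 2 * (norm (snd s))\<^sup>2"
    for t and s :: "(nat \<Rightarrow> real ^ 'k) \<times> (real ^ 'm)"
  have a: "admissible D (\<omega> (Suc t))" using Suc.prems by (intro adm) auto
  have "measure_pmf.expectation (opd_state \<eta> n b \<omega> t) (\<lambda>s. V t s + dual_loss \<eta> n b (snd s) (\<omega> (Suc t)) - S\<^sup>2 / (2 * sqrt (real n)))
    \<le> measure_pmf.expectation (opd_state \<eta> n b \<omega> t) (\<lambda>s.
      measure_pmf.expectation (opd_decision \<eta> n (snd s) (\<omega> (Suc t)))
        (\<lambda>z. V (Suc t) ((fst s)(Suc t := z), dual_update \<eta> n b (snd s) (\<omega> (Suc t)) z)))"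
  proof (intro expectation_mono_finite finite_opd_state expectation_ge_finite finite_opd_decision)
    fix s :: "(nat \<Rightarrow> real ^ 'k) \<times> (real ^ 'm)" and z
    assume z: "z \<in> set_pmf (opd_decision \<eta> n (snd s) (\<omega> (Suc t)))"
    have "(\<Sum>i=1..t. obj_coeff (\<omega> i) \<bullet> ((fst s)(Suc t := z)) i) = (\<Sum>i=1..t. obj_coeff (\<omega> i) \<bullet> fst s i)"
      by (intro sum.cong refl) simp
    thus "V t s + dual_loss \<eta> n b (snd s) (\<omega> (Suc t)) - S\<^sup>2 / (2 * sqrt (real n)) \<le>
      V (Suc t) ((fst s)(Suc t := z), dual_update \<eta> n b (snd s) (\<omega> (Suc t)) z)"
      using one_step_progress[OF a z] by (simp add: V_def)
  qed
  also have "measure_pmf.expectation (opd_state \<eta> n b \<omega> t) (\<lambda>s. V t s + dual_loss \<eta> n b (snd s) (\<omega> (Suc t)) - S\<^sup>2 / (2 * sqrt (real n))) =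
     measure_pmf.expectation (opd_state \<eta> n b \<omega> t) (V t) +
     measure_pmf.expectation (opd_state \<eta> n b \<omega> t) (\<lambda>s. dual_loss \<eta> n b (snd s) (\<omega> (Suc t))) - S\<^sup>2 / (2 * sqrt (real n))"
    by (subst Bochner_Integration.integral_diff Bochner_Integration.integral_add;
        simp add: integrable_measure_pmf_finite finite_opd_state)+
  finally show ?case
    using Suc.IH Suc.prems unfolding expectation_opd_state_Suc[of _ _ _ _ t] V_def[symmetric]
    by (simp add: ring_distribs del: times_divide_eq_right fun_upd_apply)
qed simp

text \<open>The final price term is nonpositive and is dropped; \<open>n\<close> remainders of size
  \<open>S\<^sup>2 / (2 * sqrt n)\<close> add up to order \<open>sqrt n\<close>.\<close>

lemma expected_objective_ge:
  assumes adm: "\<And>i. i \<in> {1..n} \<Longrightarrow> admissible D (\<omega> i :: ('k::finite, 'm) coeffs)"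
  shows "(\<Sum>i<n. measure_pmf.expectation (opd_state \<eta> n b \<omega> i) (\<lambda>s. dual_loss \<eta> n b (snd s) (\<omega> (Suc i))))
      - S\<^sup>2 / 2 * sqrt (real n)
    \<le> measure_pmf.expectation (opd_state \<eta> n b \<omega> n) (\<lambda>s. objective n \<omega> (fst s))"
proof -
  have "real n * (S\<^sup>2 / (2 * sqrt (real n))) = S\<^sup>2 / 2 * (real n / sqrt (real n))" by simp
  also have "\<dots> = S\<^sup>2 / 2 * sqrt (real n)" by (simp only: real_div_sqrt of_nat_0_le_iff)
  finally have "real n * (S\<^sup>2 / (2 * sqrt (real n))) = S\<^sup>2 / 2 * sqrt (real n)" .
  moreover have "measure_pmf.expectation (opd_state \<eta> n b \<omega> n)
         (\<lambda>s. (\<Sum>i=1..n. obj_coeff (\<omega> i) \<bullet> fst s i) - sqrt (real n) / 2 * (norm (snd s))\<^sup>2)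
    \<le> measure_pmf.expectation (opd_state \<eta> n b \<omega> n) (\<lambda>s. objective n \<omega> (fst s))"
    by (intro expectation_mono_finite finite_opd_state) (simp add: objective_def)
  ultimately show ?thesis using expected_progress[of \<omega> n, OF adm order_refl] by linarith
qed

text \<open>A crude bound that serves integrability. The norm of \<open>d\<close> appears twice:
  once for \<open>d \<bullet> p\<close>, once for recovering \<open>A z\<close> from the bound on
  \<open>A z - d\<close>.\<close>

lemma dual_loss_bounded:
  assumes adm: "admissible D (\<xi> :: ('k::finite, 'm) coeffs)"
  shows "\<bar>dual_loss \<eta> n b p \<xi>\<bar> \<le> D + (S + 2 * norm (b /\<^sub>R real n)) * norm p"
proof -
  have "score \<eta> n p \<xi> l \<le> D + (S + norm (b /\<^sub>R real n)) * norm p" for l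
  proof -
    let ?z = "axis l 1 :: real ^ 'k"
    have z: "?z \<in> choices" by (simp add: choices_def)
    have "norm (adj_matrix \<eta> n \<xi> *v ?z) \<le> S + norm (b /\<^sub>R real n)"
      using norm_step_le[OF adm z] norm_triangle_sub[of "adj_matrix \<eta> n \<xi> *v ?z" "b /\<^sub>R real n"] by linarith
    hence "norm p * norm (adj_matrix \<eta> n \<xi> *v ?z) \<le> norm p * (S + norm (b /\<^sub>R real n))"
      by (intro mult_left_mono) auto
    moreover have "\<bar>p \<bullet> (adj_matrix \<eta> n \<xi> *v ?z)\<bar> \<le> norm p * norm (adj_matrix \<eta> n \<xi> *v ?z)"
      by (rule Cauchy_Schwarz_ineq2)
    ultimately have "- (p \<bullet> (adj_matrix \<eta> n \<xi> *v ?z)) \<le> (S + norm (b /\<^sub>R real n)) * norm p"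
      by (simp add: mult.commute)
    thus ?thesis using abs_obj_choice_le[OF adm z] by (simp add: score_eq)
  qed
  hence "Max (range (score \<eta> n p \<xi>)) \<le> D + (S + norm (b /\<^sub>R real n)) * norm p"
    by (subst Max_le_iff) auto
  moreover have "0 \<le> D + (S + norm (b /\<^sub>R real n)) * norm p"
    using D_nonneg S_nonneg by simp
  moreover have "\<bar>(b /\<^sub>R real n) \<bullet> p\<bar> \<le> norm (b /\<^sub>R real n) * norm p" by (rule Cauchy_Schwarz_ineq2)
  moreover have "D + (S + 2 * norm (b /\<^sub>R real n)) * norm p =
    D + (S + norm (b /\<^sub>R real n)) * norm p + norm (b /\<^sub>R real n) * norm p"
    by (simp add: algebra_simps)
  ultimately show ?thesis unfolding dual_loss_def by linarith
qed

end

subsection \<open>Random coefficients\<close>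

lemma (in prob_space) expectation_diff_const:
  fixes f :: "'a \<Rightarrow> real"
  assumes "integrable M f"
  shows "integrable M (\<lambda>x. f x - c)" and "(\<integral>x. f x - c \<partial>M) = (\<integral>x. f x \<partial>M) - c"
  using assms by (simp_all add: prob_space)

locale opd_sampling = opd \<eta> n b D d_lo d_hi + P: prob_space P
  for \<eta> :: "real ^ 'm::finite" and n b D d_lo d_hi
    and P :: "('k::finite, 'm) coeffs measure" +
  assumes sets_P: "sets P = sets borel"
    and AE_admissible: "AE \<xi> in P. admissible D \<xi>"
begin

abbreviation "N \<equiv> PiM {1..n} (\<lambda>_. P)"

lemma measurable_P_eq: "measurable P M = measurable borel M"
  by (rule measurable_cong_sets[OF sets_P refl])

sublocale N: prob_space N
  by (rule prob_space_PiM) (rule P.prob_space_axioms)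

lemma AE_sample_admissible: "AE \<omega> in N. \<forall>i\<in>{1..n}. admissible D (\<omega> i)"
  by (intro AE_finite_allI AE_PiM_component P.prob_space_axioms AE_admissible) auto

lemma integrable_dual_loss: "integrable P (dual_loss \<eta> n b p)"
proof (rule P.integrable_const_bound)
  show "AE \<xi> in P. norm (dual_loss \<eta> n b p \<xi>) \<le> D + (S + 2 * norm (b /\<^sub>R real n)) * norm p"
    using AE_admissible by eventually_elim (simp only: real_norm_def dual_loss_bounded)
  have "(\<lambda>\<xi>. (p, \<xi>)) \<in> measurable borel (borel \<Otimes>\<^sub>M borel)" by simp
  from measurable_compose[OF this measurable_dual_loss]
  show "dual_loss \<eta> n b p \<in> borel_measurable P" unfolding measurable_P_eq by simp
qed

lemma integrable_isocp_value: "integrable N (isocp_value \<eta> n b)"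
proof (rule N.integrable_const_bound)
  show "AE \<omega> in N. norm (isocp_value \<eta> n b \<omega>) \<le> real n * D"
    using AE_sample_admissible by eventually_elim (simp only: real_norm_def abs_isocp_value_le)
qed (rule measurable_isocp_value[OF sets_P])

text \<open>Weak duality at a deterministic price, averaged; every coordinate of the sample has law
  \<open>P\<close>.\<close>

lemma expected_isocp_value_le:
  assumes "\<And>j. 0 \<le> p $ j"
  shows "(\<integral>\<omega>. isocp_value \<eta> n b \<omega> \<partial>N) \<le> real n * (\<integral>\<xi>. dual_loss \<eta> n b p \<xi> \<partial>P)"
proof -
  have comp: "integrable N (\<lambda>\<omega>. dual_loss \<eta> n b p (\<omega> t))"
    "(\<integral>\<omega>. dual_loss \<eta> n b p (\<omega> t) \<partial>N) = (\<integral>\<xi>. dual_loss \<eta> n b p \<xi> \<partial>P)" if t: "t \<in> {1..n}" for t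
  proof -
    have d: "distr N P (\<lambda>\<omega>. \<omega> t) = P"
      using distr_PiM_component[of "{1..n}" "\<lambda>_. P", OF P.prob_space_axioms t] .
    have m: "(\<lambda>\<omega>. \<omega> t) \<in> measurable N P" by (rule measurable_component_singleton[OF t])
    show "integrable N (\<lambda>\<omega>. dual_loss \<eta> n b p (\<omega> t))"
      by (rule integrable_distr[OF m]) (simp only: d integrable_dual_loss)
    show "(\<integral>\<omega>. dual_loss \<eta> n b p (\<omega> t) \<partial>N) = (\<integral>\<xi>. dual_loss \<eta> n b p \<xi> \<partial>P)"
      using integral_distr[OF m borel_measurable_integrable[OF integrable_dual_loss[of p]]] unfolding d by simp
  qed
  have "(\<integral>\<omega>. isocp_value \<eta> n b \<omega> \<partial>N) \<le> (\<integral>\<omega>. (\<Sum>t=1..n. dual_loss \<eta> n b p (\<omega> t)) \<partial>N)"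
  proof (intro integral_mono_AE integrable_isocp_value Bochner_Integration.integrable_sum comp)
    show "AE \<omega> in N. isocp_value \<eta> n b \<omega> \<le> (\<Sum>t=1..n. dual_loss \<eta> n b p (\<omega> t))"
      using AE_sample_admissible by eventually_elim (intro isocp_value_le_dual_loss assms, blast)
  qed
  also have "\<dots> = (\<Sum>t=1..n. \<integral>\<omega>. dual_loss \<eta> n b p (\<omega> t) \<partial>N)"
    by (intro Bochner_Integration.integral_sum comp)
  also have "\<dots> = (\<Sum>t=1..n. \<integral>\<xi>. dual_loss \<eta> n b p \<xi> \<partial>P)"
    by (intro sum.cong refl comp)
  finally show ?thesis by simp
qed

lemma integrable_expected_dual_loss:
  assumes "t < n"
  shows "integrable N (\<lambda>\<omega>. measure_pmf.expectation (opd_state \<eta> n b \<omega> t) (\<lambda>s. dual_loss \<eta> n b (snd s) (\<omega> (Suc t))))"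
proof (rule N.integrable_const_bound)
  have t: "Suc t \<in> {1..n}" "t \<le> n" using assms by auto
  have c: "0 \<le> S + 2 * norm (b /\<^sub>R real n)" using S_nonneg by simp
  show "AE \<omega> in N. norm (measure_pmf.expectation (opd_state \<eta> n b \<omega> t) (\<lambda>s. dual_loss \<eta> n b (snd s) (\<omega> (Suc t))))
     \<le> D + (S + 2 * norm (b /\<^sub>R real n)) * B"
    using AE_sample_admissible
  proof eventually_elim
    case (elim \<omega>)
    show ?case unfolding real_norm_def
    proof (intro abs_expectation_le_finite finite_opd_state)
      fix s assume s: "s \<in> set_pmf (opd_state \<eta> n b \<omega> t)"
      have "norm (snd s) \<le> B" using elim t s by (intro opd_state_price_le[where \<omega> = \<omega>]) auto
      hence "(S + 2 * norm (b /\<^sub>R real n)) * norm (snd s) \<le> (S + 2 * norm (b /\<^sub>R real n)) * B"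
        using c by (rule mult_left_mono)
      thus "\<bar>dual_loss \<eta> n b (snd s) (\<omega> (Suc t))\<bar> \<le> D + (S + 2 * norm (b /\<^sub>R real n)) * B"
        using dual_loss_bounded[of "\<omega> (Suc t)" "snd s"] elim t by fastforce
    qed
  qed
  show "(\<lambda>\<omega>. measure_pmf.expectation (opd_state \<eta> n b \<omega> t) (\<lambda>s. dual_loss \<eta> n b (snd s) (\<omega> (Suc t)))) \<in> borel_measurable N"
  proof (rule measurable_expectation_opd_state[OF sets_P t(2)], unfold snd_conv)
    have "(\<lambda>q. (snd q, fst q (Suc t))) \<in> measurable (N \<Otimes>\<^sub>M borel) (borel \<Otimes>\<^sub>M borel)"
      by (intro measurable_Pair measurable_snd measurable_compose[OF measurable_fst measurable_sample_component[OF sets_P t(1)]])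
    from measurable_compose[OF this measurable_dual_loss]
    show "(\<lambda>q. dual_loss \<eta> n b (snd q) (fst q (Suc t))) \<in> borel_measurable (N \<Otimes>\<^sub>M borel)"
      by (simp only: fst_conv snd_conv)
  qed
qed

text \<open>
  The price of round \<open>t + 1\<close> depends only on the first \<open>t\<close> tuples, so \<open>\<omega> (t + 1)\<close> can be
  integrated first. Subtracting \<open>\<rho>\<close> makes the outer integrand nonnegative, so that its
  integrability is not needed.
\<close>

lemma expected_dual_loss_ge:
  assumes t: "t < n" and \<rho>: "\<And>p. (\<And>j. 0 \<le> p $ j) \<Longrightarrow> \<rho> \<le> (\<integral>\<xi>. dual_loss \<eta> n b p \<xi> \<partial>P)"
  shows "\<rho> \<le> (\<integral>\<omega>. measure_pmf.expectation (opd_state \<eta> n b \<omega> t) (\<lambda>s. dual_loss \<eta> n b (snd s) (\<omega> (Suc t))) \<partial>N)"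
proof -
  interpret PP: product_sigma_finite "\<lambda>_. P"
    by (simp add: product_sigma_finite_def P.sigma_finite_measure_axioms)
  define I where "I = {1..n} - {Suc t}"
  define Q where "Q \<omega> = measure_pmf.expectation (opd_state \<eta> n b \<omega> t) (\<lambda>s. dual_loss \<eta> n b (snd s) (\<omega> (Suc t)))"
    for \<omega> :: "nat \<Rightarrow> ('k, 'm) coeffs"
  have I: "finite I" "Suc t \<notin> I" "insert (Suc t) I = {1..n}" using t by (auto simp: I_def)
  have int: "integrable N (\<lambda>\<omega>. Q \<omega> - \<rho>)"
    unfolding Q_def by (intro N.expectation_diff_const integrable_expected_dual_loss t)
  have "0 \<le> (\<integral>\<omega>. (\<integral>\<xi>. Q (\<omega> (Suc t := \<xi>)) - \<rho> \<partial>P) \<partial>PiM I (\<lambda>_. P))"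
  proof (rule Bochner_Integration.integral_nonneg)
    fix \<omega> :: "nat \<Rightarrow> ('k, 'm) coeffs"
    let ?M = "opd_state \<eta> n b \<omega> t"
    have "opd_state \<eta> n b (\<omega> (Suc t := \<xi>)) t = ?M" for \<xi>
      by (rule opd_state_cong) simp
    \<comment> \<open>The law \<open>?M\<close> does not involve \<open>\<xi>\<close>, so this is a
      finite sum with constant weights and the integral over \<open>P\<close> passes inside.\<close>
    hence "Q (\<omega> (Suc t := \<xi>)) = (\<Sum>s\<in>set_pmf ?M. pmf ?M s *\<^sub>R dual_loss \<eta> n b (snd s) \<xi>)" for \<xi>
      unfolding Q_def fun_upd_same by (simp only: integral_measure_pmf[OF finite_opd_state])
    hence "(\<integral>\<xi>. Q (\<omega> (Suc t := \<xi>)) - \<rho> \<partial>P) =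
        (\<integral>\<xi>. (\<Sum>s\<in>set_pmf ?M. pmf ?M s *\<^sub>R dual_loss \<eta> n b (snd s) \<xi>) - \<rho> \<partial>P)" by simp
    also have "\<dots> = (\<integral>\<xi>. (\<Sum>s\<in>set_pmf ?M. pmf ?M s *\<^sub>R dual_loss \<eta> n b (snd s) \<xi>) \<partial>P) - \<rho>"
      by (intro P.expectation_diff_const Bochner_Integration.integrable_sum integrable_scaleR_right integrable_dual_loss)
    also have "(\<integral>\<xi>. (\<Sum>s\<in>set_pmf ?M. pmf ?M s *\<^sub>R dual_loss \<eta> n b (snd s) \<xi>) \<partial>P) =
        (\<Sum>s\<in>set_pmf ?M. pmf ?M s *\<^sub>R (\<integral>\<xi>. dual_loss \<eta> n b (snd s) \<xi> \<partial>P))"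
      by (subst Bochner_Integration.integral_sum) (auto intro!: integrable_dual_loss)
    also have "\<dots> = measure_pmf.expectation ?M (\<lambda>s. \<integral>\<xi>. dual_loss \<eta> n b (snd s) \<xi> \<partial>P)"
      by (rule integral_measure_pmf[OF finite_opd_state, symmetric])
    finally have "(\<integral>\<xi>. Q (\<omega> (Suc t := \<xi>)) - \<rho> \<partial>P) =
        measure_pmf.expectation ?M (\<lambda>s. \<integral>\<xi>. dual_loss \<eta> n b (snd s) \<xi> \<partial>P) - \<rho>" .
    moreover have "\<rho> \<le> measure_pmf.expectation ?M (\<lambda>s. \<integral>\<xi>. dual_loss \<eta> n b (snd s) \<xi> \<partial>P)"
      by (intro expectation_ge_finite finite_opd_state \<rho> opd_state_price_nonneg)
    ultimately show "0 \<le> (\<integral>\<xi>. Q (\<omega> (Suc t := \<xi>)) - \<rho> \<partial>P)" by linarith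
  qed
  also have "\<dots> = (\<integral>\<omega>. Q \<omega> - \<rho> \<partial>N)"
    using PP.product_integral_insert[OF I(1,2), of "\<lambda>\<omega>. Q \<omega> - \<rho>"] int unfolding I(3) by simp
  also have "\<dots> = (\<integral>\<omega>. Q \<omega> \<partial>N) - \<rho>"
    unfolding Q_def by (intro N.expectation_diff_const integrable_expected_dual_loss t)
  finally show ?thesis by (simp add: Q_def)
qed

section \<open>Expected violation and expected regret\<close>

lemma tie_expectation_eq:
  "tie_expectation \<eta> n b f \<omega> = measure_pmf.expectation (opd_state \<eta> n b \<omega> n) (\<lambda>s. f \<omega> (fst s))"
  by (simp add: tie_expectation_def opd_output_def)

lemma measurable_tie_expectation:
  assumes "\<And>x. (\<lambda>\<omega>. f \<omega> x) \<in> borel_measurable N"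
  shows "tie_expectation \<eta> n b f \<in> borel_measurable N"
  unfolding tie_expectation_eq[abs_def]
  by (rule measurable_expectation_opd_state[OF sets_P order_refl], unfold fst_conv)
     (rule measurable_compose[OF measurable_fst assms])

lemma integrable_tie_expectation:
  assumes "\<And>x. (\<lambda>\<omega>. f \<omega> x) \<in> borel_measurable N"
    and "\<And>\<omega> s. (\<And>i. i \<in> {1..n} \<Longrightarrow> admissible D (\<omega> i)) \<Longrightarrow>
          s \<in> set_pmf (opd_state \<eta> n b \<omega> n) \<Longrightarrow> \<bar>f \<omega> (fst s)\<bar> \<le> c"
  shows "integrable N (tie_expectation \<eta> n b f)"
proof (rule N.integrable_const_bound)
  show "AE \<omega> in N. norm (tie_expectation \<eta> n b f \<omega>) \<le> c"
    using AE_sample_admissible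
  proof eventually_elim
    case (elim \<omega>)
    show ?case unfolding real_norm_def tie_expectation_eq
      using elim by (intro abs_expectation_le_finite finite_opd_state assms(2)) auto
  qed
qed (intro measurable_tie_expectation assms(1))

lemma integrable_tie_violation: "integrable N (tie_expectation \<eta> n b (violation \<eta> n b))"
proof (rule integrable_tie_expectation)
  show "(\<lambda>\<omega>. violation \<eta> n b \<omega> x) \<in> borel_measurable N" for x
    by (rule measurable_violation[OF sets_P])
  fix \<omega> :: "nat \<Rightarrow> ('k, 'm) coeffs" and s
  assume "\<And>i. i \<in> {1..n} \<Longrightarrow> admissible D (\<omega> i)" "s \<in> set_pmf (opd_state \<eta> n b \<omega> n)"
  from violation_le[of \<omega>, OF this]
  show "\<bar>violation \<eta> n b \<omega> (fst s)\<bar> \<le> violation_bound \<eta> D d_lo d_hi * sqrt (real n)"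
    by (simp add: violation_def)
qed

lemma expected_violation_le:
  "(\<integral>\<omega>. tie_expectation \<eta> n b (violation \<eta> n b) \<omega> \<partial>N) \<le> violation_bound \<eta> D d_lo d_hi * sqrt (real n)"
proof (intro N.integral_le_const integrable_tie_violation)
  show "AE \<omega> in N. tie_expectation \<eta> n b (violation \<eta> n b) \<omega> \<le> violation_bound \<eta> D d_lo d_hi * sqrt (real n)"
    using AE_sample_admissible
  proof eventually_elim
    case (elim \<omega>)
    thus ?case unfolding tie_expectation_eq
      by (intro expectation_le_finite finite_opd_state violation_le) auto
  qed
qed

lemma integrable_tie_objective: "integrable N (tie_expectation \<eta> n b (objective n))"
proof (rule integrable_tie_expectation)
  show "(\<lambda>\<omega>. objective n \<omega> x) \<in> borel_measurable N" for x
    by (rule measurable_objective[OF sets_P])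
  fix \<omega> :: "nat \<Rightarrow> ('k, 'm) coeffs" and s
  assume "\<And>i. i \<in> {1..n} \<Longrightarrow> admissible D (\<omega> i)" "s \<in> set_pmf (opd_state \<eta> n b \<omega> n)"
  thus "\<bar>objective n \<omega> (fst s)\<bar> \<le> real n * D"
    by (intro abs_objective_le opd_state_choices)
qed

lemma tie_expectation_regret:
  "tie_expectation \<eta> n b (regret \<eta> n b) = (\<lambda>\<omega>. isocp_value \<eta> n b \<omega> - tie_expectation \<eta> n b (objective n) \<omega>)"
  unfolding tie_expectation_eq[abs_def] regret_def
  by (rule ext, subst Bochner_Integration.integral_diff)
     (simp_all add: integrable_measure_pmf_finite finite_opd_state)

lemma integrable_tie_regret: "integrable N (tie_expectation \<eta> n b (regret \<eta> n b))"
  unfolding tie_expectation_regret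
  by (intro Bochner_Integration.integrable_diff integrable_isocp_value integrable_tie_objective)

lemma expected_regret_le:
  "(\<integral>\<omega>. tie_expectation \<eta> n b (regret \<eta> n b) \<omega> \<partial>N) \<le> S\<^sup>2 / 2 * sqrt (real n)"
proof -
  define R where "R = (\<integral>\<omega>. isocp_value \<eta> n b \<omega> \<partial>N)"
  define Q where "Q t \<omega> = measure_pmf.expectation (opd_state \<eta> n b \<omega> t) (\<lambda>s. dual_loss \<eta> n b (snd s) (\<omega> (Suc t)))"
    for t and \<omega> :: "nat \<Rightarrow> ('k, 'm) coeffs"
  have int: "integrable N (Q t)" if "t < n" for t
    unfolding Q_def using that by (rule integrable_expected_dual_loss)
  \<comment> \<open>Averaged weak duality bounds the expected dual loss below by
    \<open>R / n\<close> at every nonnegative price, so this level may serve as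
    \<open>\<rho>\<close> for the random price of each round; summing over \<open>n\<close> rounds
    recovers \<open>R\<close>.\<close>
  have "R / real n \<le> (\<integral>\<omega>. Q t \<omega> \<partial>N)" if "t < n" for t
    unfolding Q_def
  proof (rule expected_dual_loss_ge[OF that])
    fix p :: "real ^ 'm" assume "\<And>j. 0 \<le> p $ j"
    from expected_isocp_value_le[OF this] show "R / real n \<le> (\<integral>\<xi>. dual_loss \<eta> n b p \<xi> \<partial>P)"
      using n_gt_0 by (simp add: R_def pos_divide_le_eq mult.commute)
  qed
  hence "(\<Sum>t<n. R / real n) \<le> (\<Sum>t<n. \<integral>\<omega>. Q t \<omega> \<partial>N)" by (intro sum_mono) auto
  hence "R \<le> (\<Sum>t<n. \<integral>\<omega>. Q t \<omega> \<partial>N)" using n_gt_0 by simp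
  also have "\<dots> = (\<integral>\<omega>. (\<Sum>t<n. Q t \<omega>) \<partial>N)"
    by (intro Bochner_Integration.integral_sum[symmetric] int) simp
  finally have "R - S\<^sup>2 / 2 * sqrt (real n) \<le> (\<integral>\<omega>. (\<Sum>t<n. Q t \<omega>) \<partial>N) - S\<^sup>2 / 2 * sqrt (real n)" by simp
  also have "\<dots> = (\<integral>\<omega>. (\<Sum>t<n. Q t \<omega>) - S\<^sup>2 / 2 * sqrt (real n) \<partial>N)"
    by (intro N.expectation_diff_const(2)[symmetric] Bochner_Integration.integrable_sum int) simp
  also have "\<dots> \<le> (\<integral>\<omega>. tie_expectation \<eta> n b (objective n) \<omega> \<partial>N)"
  proof (rule integral_mono_AE)
    show "integrable N (\<lambda>\<omega>. (\<Sum>t<n. Q t \<omega>) - S\<^sup>2 / 2 * sqrt (real n))"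
      by (intro N.expectation_diff_const Bochner_Integration.integrable_sum int) simp
    show "AE \<omega> in N. (\<Sum>t<n. Q t \<omega>) - S\<^sup>2 / 2 * sqrt (real n) \<le> tie_expectation \<eta> n b (objective n) \<omega>"
      using AE_sample_admissible
    proof eventually_elim
      case (elim \<omega>)
      thus ?case unfolding tie_expectation_eq Q_def by (intro expected_objective_ge) blast
    qed
  qed (rule integrable_tie_objective)
  finally show ?thesis
    unfolding tie_expectation_regret R_def
    by (simp add: Bochner_Integration.integral_diff[OF integrable_isocp_value integrable_tie_objective]
        del: One_nat_def)
qed

end

theorem theorem1:
  fixes \<eta> :: "real ^ 'm::finite"
    and d_lo d_hi :: real
    and P :: "('k::finite, 'm) coeffs measure"
  assumes "\<forall>j. 1/2 < \<eta> $ j \<and> \<eta> $ j < 1"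
    and "0 < d_lo" and "d_lo \<le> d_hi"
    and "prob_space P" and "sets P = sets borel"
    and "bounded (topological_support P)"
    and "AE \<xi> in P. \<forall>j. covariance_matrix (cov_coeff \<xi> j)"
  shows "\<exists>C. \<forall>n\<ge>1. \<forall>b :: real ^ 'm.
           (\<forall>j. d_lo \<le> b $ j / real n \<and> b $ j / real n \<le> d_hi) \<longrightarrow>
             integrable (sample_measure P n) (tie_expectation \<eta> n b (regret \<eta> n b)) \<and>
             (\<integral>\<omega>. tie_expectation \<eta> n b (regret \<eta> n b) \<omega> \<partial>sample_measure P n) \<le> C * sqrt (real n) \<and>
             integrable (sample_measure P n) (tie_expectation \<eta> n b (violation \<eta> n b)) \<and>
             (\<integral>\<omega>. tie_expectation \<eta> n b (violation \<eta> n b) \<omega> \<partial>sample_measure P n) \<le> C * sqrt (real n)"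
proof -
  obtain D where D: "\<And>\<xi>. \<xi> \<in> topological_support P \<Longrightarrow> norm \<xi> \<le> D" "0 < D"
    using assms(6) by (auto simp: bounded_pos)
  have adm: "AE \<xi> in P. admissible D \<xi>"
    using AE_in_topological_support[OF assms(5)] assms(7)
    by eventually_elim (auto simp: admissible_def D)
  \<comment> \<open>Both bounds are built from \<open>\<eta>\<close>, \<open>D\<close>,
    \<open>d_lo\<close> and \<open>d_hi\<close>, so \<open>C\<close> is fixed before
    \<open>n\<close> and \<open>b\<close>.\<close>
  define C where "C = max ((step_bound \<eta> D d_hi)\<^sup>2 / 2) (violation_bound \<eta> D d_lo d_hi)"
  have C: "x * sqrt (real n) \<le> C * sqrt (real n)"
    if "x \<in> {(step_bound \<eta> D d_hi)\<^sup>2 / 2, violation_bound \<eta> D d_lo d_hi}" for x n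
    using that by (intro mult_right_mono) (auto simp: C_def)
  show ?thesis
  proof (intro exI[of _ C] allI impI)
    fix n :: nat and b :: "real ^ 'm"
    assume n: "1 \<le> n" and b: "\<forall>j. d_lo \<le> b $ j / real n \<and> b $ j / real n \<le> d_hi"
    have "0 \<le> std_normal_quantile (\<eta> $ j)" for j
      using assms(1) by (intro std_normal_quantile_nonneg) (auto intro: less_imp_le)
    then interpret opd_sampling \<eta> n b D d_lo d_hi P
      unfolding opd_sampling_def opd_sampling_axioms_def opd_def
      using assms(2,4,5) n b D(2) adm by simp
    show "integrable (sample_measure P n) (tie_expectation \<eta> n b (regret \<eta> n b)) \<and>
       (\<integral>\<omega>. tie_expectation \<eta> n b (regret \<eta> n b) \<omega> \<partial>sample_measure P n) \<le> C * sqrt (real n) \<and>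
       integrable (sample_measure P n) (tie_expectation \<eta> n b (violation \<eta> n b)) \<and>
       (\<integral>\<omega>. tie_expectation \<eta> n b (violation \<eta> n b) \<omega> \<partial>sample_measure P n) \<le> C * sqrt (real n)"
      unfolding sample_measure_def
      using integrable_tie_regret integrable_tie_violation
        order_trans[OF expected_regret_le C] order_trans[OF expected_violation_le C] by simp
  qed
qed

end
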